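(* Let $w,y,z>0$ and let $(A,B)\sim\beta(w,y)\otimes\beta(y,z)$. Set $(a,b)=(w+y,\,y+z)$. Then all of the following hold. (i) For $V_2\sim\Gamma_b$, $V_1\sim\Gamma_a$ is the unique (in distribution) solution to $V_1\overset{d}{=}AV_1+BV_2$, where $V_1,V_2,(A,B)$ are mutually independent. (ii) $X\sim\beta(a,b)$ is the unique (in distribution) solution to $X\overset{d}{=}AX+B(1-X)$, where $X$ is independent of $(A,B)$. (iii) There is a random variable $Y\sim\beta(a,b)$ such that, as $n\to\infty$, $Y_n(x)\to Y$ almost surely, uniformly in $x\in[0,1]$. (iv) For every $x\in[0,1]$, $X_n(x)$ converges in distribution to $\beta(a,b)$ as $n\to\infty$. (v) For every $x'\in(0,\infty)$, $X'_n(x')$ converges in distribution to $\Gamma_a$ as $n\to\infty$.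
   Context: $\overset{d}{=}$ denotes equality in distribution. $\beta(a,b)$, $a,b>0$, is the beta distribution with density $B(a,b)^{-1}u^{a-1}(1-u)^{b-1}$ on $(0,1)$. $\Gamma_a$, $a>0$, is the gamma distribution with shape $a$ and scale $1$. $F_1\otimes F_2$ denotes the joint law of independent random elements with laws $F_1$, $F_2$. A solution of a random equation is a real random variable (or its law) satisfying it; uniqueness is in distribution. Let $\mu$ be the law of $(A,B)$ and let $(A_1,B_1,V_1),(A_2,B_2,V_2),\dots$ be i.i.d. with law $\mu\otimes\Gamma_b$. Put $F_n(x)=A_nx+B_n(1-x)$ for $x\in[0,1]$ and $G_n(x')=A_nx'+B_nV_n$ for $x'\in(0,\infty)$. Define, for $n\ge1$, $X_n=F_n\circ F_{n-1}\circ\cdots\circ F_1$ (forward iteration), $Y_n=F_1\circ F_2\circ\cdots\circ F_n$ (backward iteration), and $X'_n=G_n\circ G_{n-1}\circ\cdots\circ G_1$. *)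

theory Defs
  imports "HOL-Probability.Probability"
begin

section \<open>Beta and gamma distributions\<close>

definition beta_distr :: "real \<Rightarrow> real \<Rightarrow> real measure" where
  "beta_distr a b = density lborel
     (\<lambda>u. ennreal (indicator {0<..<1} u * (u powr (a - 1) * (1 - u) powr (b - 1) / Beta a b)))"

definition gamma_distr :: "real \<Rightarrow> real measure" where
  "gamma_distr a = density lborel
     (\<lambda>v. ennreal (indicator {0<..} v * (v powr (a - 1) * exp (- v) / Gamma a)))"

lemma sets_beta_distr [simp, measurable_cong]: "sets (beta_distr a b) = sets borel"
  by (simp add: beta_distr_def)

lemma sets_gamma_distr [simp, measurable_cong]: "sets (gamma_distr a) = sets borel"
  by (simp add: gamma_distr_def)

lemma prob_space_beta_distr:
  assumes "a > 0" "b > 0"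
  shows "prob_space (beta_distr a b)"
proof
  have B: "Beta a b > 0"
    using assms by (simp add: Beta_def)
  let ?f = "\<lambda>u. u powr (a - 1) * (1 - u) powr (b - 1)"
  have "emeasure (beta_distr a b) (space (beta_distr a b)) =
      (\<integral>\<^sup>+u. ennreal (1 / Beta a b) * ennreal (indicator {0..1} u * ?f u) \<partial>lborel)"
    unfolding beta_distr_def
  proof (subst emeasure_density)
    show "(\<integral>\<^sup>+u. ennreal (indicator {0<..<1} u * (?f u / Beta a b)) *
          indicator (space (density lborel (\<lambda>u. ennreal (indicator {0<..<1} u * (?f u / Beta a b))))) u \<partial>lborel)
        = (\<integral>\<^sup>+u. ennreal (1 / Beta a b) * ennreal (indicator {0..1} u * ?f u) \<partial>lborel)"
    proof (rule nn_integral_cong)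
      fix u :: real
      have "indicator {0<..<1} u * ?f u = indicator {0..1} u * ?f u"
        by (cases "u = 0 \<or> u = 1") (auto simp: indicator_def)
      then show "ennreal (indicator {0<..<1} u * (?f u / Beta a b)) *
          indicator (space (density lborel (\<lambda>u. ennreal (indicator {0<..<1} u * (?f u / Beta a b))))) u
        = ennreal (1 / Beta a b) * ennreal (indicator {0..1} u * ?f u)"
        using B by (simp flip: ennreal_mult)
    qed
  qed simp_all
  also have "\<dots> = ennreal (1 / Beta a b) * (\<integral>\<^sup>+u. ennreal (indicator {0..1} u * ?f u) \<partial>lborel)"
    by (rule nn_integral_cmult) simp
  also have "(\<integral>\<^sup>+u. ennreal (indicator {0..1} u * ?f u) \<partial>lborel) = ennreal (Beta a b)"
    by (rule nn_integral_has_integral_lebesgue[OF _ has_integral_Beta_real[OF assms]]) simp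
  also have "ennreal (1 / Beta a b) * ennreal (Beta a b) = 1"
    using B by (simp flip: ennreal_mult)
  finally show "emeasure (beta_distr a b) (space (beta_distr a b)) = 1" .
qed

lemma prob_space_gamma_distr:
  assumes "a > 0"
  shows "prob_space (gamma_distr a)"
proof
  have G: "Gamma a > 0"
    using assms by simp
  let ?f = "\<lambda>v. v powr (a - 1) / exp v"
  have "emeasure (gamma_distr a) (space (gamma_distr a)) =
      (\<integral>\<^sup>+v. ennreal (1 / Gamma a) * ennreal (indicator {0..} v * ?f v) \<partial>lborel)"
    unfolding gamma_distr_def
  proof (subst emeasure_density)
    show "(\<integral>\<^sup>+v. ennreal (indicator {0<..} v * (v powr (a - 1) * exp (- v) / Gamma a)) *
          indicator (space (density lborel
            (\<lambda>v. ennreal (indicator {0<..} v * (v powr (a - 1) * exp (- v) / Gamma a))))) v \<partial>lborel)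
        = (\<integral>\<^sup>+v. ennreal (1 / Gamma a) * ennreal (indicator {0..} v * ?f v) \<partial>lborel)"
    proof (rule nn_integral_cong)
      fix v :: real
      have "indicator {0<..} v * (v powr (a - 1) * exp (- v)) = indicator {0..} v * ?f v"
        by (cases "v = 0") (auto simp: indicator_def exp_minus field_simps)
      then show "ennreal (indicator {0<..} v * (v powr (a - 1) * exp (- v) / Gamma a)) *
          indicator (space (density lborel
            (\<lambda>v. ennreal (indicator {0<..} v * (v powr (a - 1) * exp (- v) / Gamma a))))) v
        = ennreal (1 / Gamma a) * ennreal (indicator {0..} v * ?f v)"
        using G by (simp flip: ennreal_mult)
    qed
  qed simp_all
  also have "\<dots> = ennreal (1 / Gamma a) * (\<integral>\<^sup>+v. ennreal (indicator {0..} v * ?f v) \<partial>lborel)"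
    by (rule nn_integral_cmult) simp
  also have "(\<integral>\<^sup>+v. ennreal (indicator {0..} v * ?f v) \<partial>lborel) = ennreal (Gamma a)"
    by (rule nn_integral_has_integral_lebesgue[OF _ Gamma_integral_real[OF assms]]) simp
  also have "ennreal (1 / Gamma a) * ennreal (Gamma a) = 1"
    using G by (simp flip: ennreal_mult)
  finally show "emeasure (gamma_distr a) (space (gamma_distr a)) = 1" .
qed


section \<open>Random equations\<close>

text \<open>
  A solution is a law \<open>\<nu>\<close> on the real line.  Mutually independent random elements with laws
  \<open>\<nu>\<close>, \<open>\<kappa>\<close>, \<open>\<mu>\<close> are realised as the coordinates of the product space; the random-variable lemmas below
  show that this is the same as the equation between the distributions of random variables
  on an arbitrary probability space.
\<close>

text \<open>The equation \<open>V\<^sub>1 = A V\<^sub>1 + B V\<^sub>2\<close> in distribution,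
  with \<open>V\<^sub>1 \<sim> \<nu>\<close>, \<open>V\<^sub>2 \<sim> \<kappa>\<close>, \<open>(A, B) \<sim> \<mu>\<close> mutually independent.\<close>
definition solves_sum_eq :: "(real \<times> real) measure \<Rightarrow> real measure \<Rightarrow> real measure \<Rightarrow> bool" where
  "solves_sum_eq \<mu> \<kappa> \<nu> \<longleftrightarrow> prob_space \<nu> \<and> sets \<nu> = sets borel \<and>
     \<nu> = distr (\<nu> \<Otimes>\<^sub>M (\<kappa> \<Otimes>\<^sub>M \<mu>)) borel (\<lambda>(v1, v2, (A, B)). A * v1 + B * v2)"

text \<open>The equation \<open>X = A X + B (1 - X)\<close> in distribution,
  with \<open>X \<sim> \<nu>\<close> independent of \<open>(A, B) \<sim> \<mu>\<close>.\<close>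
definition solves_mix_eq :: "(real \<times> real) measure \<Rightarrow> real measure \<Rightarrow> bool" where
  "solves_mix_eq \<mu> \<nu> \<longleftrightarrow> prob_space \<nu> \<and> sets \<nu> = sets borel \<and>
     \<nu> = distr (\<nu> \<Otimes>\<^sub>M \<mu>) borel (\<lambda>(x, (A, B)). A * x + B * (1 - x))"

lemma (in prob_space) indep_set_joint_distr:
  assumes [measurable]: "X \<in> M \<rightarrow>\<^sub>M S" "Y \<in> M \<rightarrow>\<^sub>M T"
    and ind: "indep_set (sets (vimage_algebra (space M) X S)) (sets (vimage_algebra (space M) Y T))"
  shows "distr M S X \<Otimes>\<^sub>M distr M T Y = distr M (S \<Otimes>\<^sub>M T) (\<lambda>\<omega>. (X \<omega>, Y \<omega>))"
proof (rule pair_measure_eqI)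
  interpret X: prob_space "distr M S X" by (rule prob_space_distr) simp
  interpret Y: prob_space "distr M T Y" by (rule prob_space_distr) simp
  show "sigma_finite_measure (distr M S X)" "sigma_finite_measure (distr M T Y)"
    by unfold_locales
  fix C D assume C: "C \<in> sets (distr M S X)" and D: "D \<in> sets (distr M T Y)"
  then have [measurable]: "C \<in> sets S" "D \<in> sets T" by auto
  have "X -` C \<inter> space M \<in> sets (vimage_algebra (space M) X S)"
    "Y -` D \<inter> space M \<in> sets (vimage_algebra (space M) Y T)"
    by (auto intro: in_vimage_algebra)
  from indep_setD[OF ind this]
  have "prob ((X -` C \<inter> space M) \<inter> (Y -` D \<inter> space M))
      = prob (X -` C \<inter> space M) * prob (Y -` D \<inter> space M)" .
  moreover have "(X -` C \<inter> space M) \<inter> (Y -` D \<inter> space M) = (\<lambda>\<omega>. (X \<omega>, Y \<omega>)) -` (C \<times> D) \<inter> space M"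
    by auto
  ultimately show "emeasure (distr M S X) C * emeasure (distr M T Y) D
      = emeasure (distr M (S \<Otimes>\<^sub>M T) (\<lambda>\<omega>. (X \<omega>, Y \<omega>))) (C \<times> D)"
    by (simp add: emeasure_distr emeasure_eq_measure ennreal_mult)
qed simp

lemma (in prob_space) solves_sum_eq_random_variables:
  fixes A B V1 V2 :: "'a \<Rightarrow> real"
  assumes [measurable]: "V1 \<in> borel_measurable M" "V2 \<in> borel_measurable M"
      "A \<in> borel_measurable M" "B \<in> borel_measurable M"
    and 1: "indep_set (sets (vimage_algebra (space M) V1 borel))
      (sets (vimage_algebra (space M) (\<lambda>\<omega>. (V2 \<omega>, (A \<omega>, B \<omega>))) (borel \<Otimes>\<^sub>M (borel \<Otimes>\<^sub>M borel))))"
    and 2: "indep_set (sets (vimage_algebra (space M) V2 borel))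
      (sets (vimage_algebra (space M) (\<lambda>\<omega>. (A \<omega>, B \<omega>)) (borel \<Otimes>\<^sub>M borel)))"
  shows "solves_sum_eq (distr M (borel \<Otimes>\<^sub>M borel) (\<lambda>\<omega>. (A \<omega>, B \<omega>))) (distr M borel V2) (distr M borel V1)
    \<longleftrightarrow> distr M borel V1 = distr M borel (\<lambda>\<omega>. A \<omega> * V1 \<omega> + B \<omega> * V2 \<omega>)"
proof -
  have "distr M borel V1 \<Otimes>\<^sub>M
      (distr M borel V2 \<Otimes>\<^sub>M distr M (borel \<Otimes>\<^sub>M borel) (\<lambda>\<omega>. (A \<omega>, B \<omega>)))
    = distr M (borel \<Otimes>\<^sub>M (borel \<Otimes>\<^sub>M (borel \<Otimes>\<^sub>M borel))) (\<lambda>\<omega>. (V1 \<omega>, V2 \<omega>, (A \<omega>, B \<omega>)))"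
    using indep_set_joint_distr[OF _ _ 1] indep_set_joint_distr[OF _ _ 2] by simp
  then show ?thesis
    by (simp add: solves_sum_eq_def distr_distr comp_def prob_space_distr)
qed

lemma (in prob_space) solves_mix_eq_random_variables:
  fixes A B X :: "'a \<Rightarrow> real"
  assumes [measurable]: "X \<in> borel_measurable M"
      "A \<in> borel_measurable M" "B \<in> borel_measurable M"
    and 1: "indep_set (sets (vimage_algebra (space M) X borel))
      (sets (vimage_algebra (space M) (\<lambda>\<omega>. (A \<omega>, B \<omega>)) (borel \<Otimes>\<^sub>M borel)))"
  shows "solves_mix_eq (distr M (borel \<Otimes>\<^sub>M borel) (\<lambda>\<omega>. (A \<omega>, B \<omega>))) (distr M borel X)
    \<longleftrightarrow> distr M borel X = distr M borel (\<lambda>\<omega>. A \<omega> * X \<omega> + B \<omega> * (1 - X \<omega>))"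
proof -
  have "distr M borel X \<Otimes>\<^sub>M distr M (borel \<Otimes>\<^sub>M borel) (\<lambda>\<omega>. (A \<omega>, B \<omega>))
    = distr M (borel \<Otimes>\<^sub>M (borel \<Otimes>\<^sub>M borel)) (\<lambda>\<omega>. (X \<omega>, (A \<omega>, B \<omega>)))"
    using indep_set_joint_distr[OF _ _ 1] by simp
  then show ?thesis
    by (simp add: solves_mix_eq_def distr_distr comp_def prob_space_distr)
qed


section \<open>Iterated random functions\<close>

text \<open>\<open>F\<^sub>n \<circ> \<dots> \<circ> F\<^sub>1\<close> and \<open>F\<^sub>1 \<circ> \<dots> \<circ> F\<^sub>n\<close>; the value \<open>F 0\<close> is not used.\<close>

fun forward_iter :: "(nat \<Rightarrow> 'a \<Rightarrow> 'a) \<Rightarrow> nat \<Rightarrow> 'a \<Rightarrow> 'a" where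
  "forward_iter F 0 = id"
| "forward_iter F (Suc n) = F (Suc n) \<circ> forward_iter F n"

fun backward_iter :: "(nat \<Rightarrow> 'a \<Rightarrow> 'a) \<Rightarrow> nat \<Rightarrow> 'a \<Rightarrow> 'a" where
  "backward_iter F 0 = id"
| "backward_iter F (Suc n) = backward_iter F n \<circ> F (Suc n)"

definition mix_map :: "(nat \<Rightarrow> 'w \<Rightarrow> real) \<Rightarrow> (nat \<Rightarrow> 'w \<Rightarrow> real) \<Rightarrow> 'w \<Rightarrow> nat \<Rightarrow> real \<Rightarrow> real" where
  "mix_map A B \<omega> n x = A n \<omega> * x + B n \<omega> * (1 - x)"

definition sum_map :: "(nat \<Rightarrow> 'w \<Rightarrow> real) \<Rightarrow> (nat \<Rightarrow> 'w \<Rightarrow> real) \<Rightarrow> (nat \<Rightarrow> 'w \<Rightarrow> real) \<Rightarrow>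
    'w \<Rightarrow> nat \<Rightarrow> real \<Rightarrow> real" where
  "sum_map A B V \<omega> n x = A n \<omega> * x + B n \<omega> * V n \<omega>"

end

theory Submission
  imports Defs
begin

text \<open>
  Existence is the beta-gamma algebra: if \<open>V\<^sub>1 \<sim> \<Gamma>\<^bsub>w+y\<^esub>\<close> and \<open>V\<^sub>2 \<sim> \<Gamma>\<^bsub>y+z\<^esub>\<close> are thinned by \<open>A\<close> and \<open>B\<close>,
  then \<open>A V\<^sub>1\<close>, \<open>(1 - A) V\<^sub>1\<close>, \<open>B V\<^sub>2\<close>, \<open>(1 - B) V\<^sub>2\<close> are independent gamma variables with shapes
  \<open>w\<close>, \<open>y\<close>, \<open>y\<close>, \<open>z\<close>, and regrouping them gives both equations.

  Uniqueness and convergence come from contraction: both recursions iterate i.i.d. random affine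
  maps \<open>x \<mapsto> p x + q\<close> with \<open>\<bar>p\<bar> < 1\<close> almost surely.  The transfer operator \<open>P f x = E f (p x + q)\<close>
  multiplies Lipschitz constants by \<open>E \<bar>p\<bar> < 1\<close>, so \<open>P\<^sup>n f\<close> converges pointwise to \<open>\<integral> f d\<nu>\<close>
  for every bounded Lipschitz \<open>f\<close> and every stationary law \<open>\<nu>\<close>; it suffices to take
  \<open>f x = exp (i t x)\<close>.  Both the forward and the backward iterate started at \<open>x\<close> satisfy
  \<open>E f = P\<^sup>n f x\<close>.  The backward iterates map \<open>[0, 1]\<close> to nested intervals whose lengths have
  summable expectations, hence they shrink to a point almost surely.
\<close>

section \<open>Beta-gamma algebra\<close>

definition beta_dens :: "real \<Rightarrow> real \<Rightarrow> real \<Rightarrow> real" where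
  "beta_dens a b u = indicator {0<..<1} u * (u powr (a - 1) * (1 - u) powr (b - 1) / Beta a b)"

definition gamma_dens :: "real \<Rightarrow> real \<Rightarrow> real" where
  "gamma_dens a v = indicator {0<..} v * (v powr (a - 1) * exp (- v) / Gamma a)"

lemma measurable_beta_dens [measurable]: "beta_dens a b \<in> borel_measurable borel"
  unfolding beta_dens_def by measurable

lemma measurable_gamma_dens [measurable]: "gamma_dens a \<in> borel_measurable borel"
  unfolding gamma_dens_def by measurable

lemma gamma_dens_nonneg: "a > 0 \<Longrightarrow> gamma_dens a v \<ge> 0"
  by (simp add: gamma_dens_def indicator_def)

lemma beta_dens_nonneg: "a > 0 \<Longrightarrow> b > 0 \<Longrightarrow> beta_dens a b v \<ge> 0"
  by (simp add: beta_dens_def indicator_def Beta_def)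

lemma nn_integral_beta_distr:
  assumes [measurable]: "f \<in> borel_measurable borel"
  shows "(\<integral>\<^sup>+u. f u \<partial>beta_distr a b) = (\<integral>\<^sup>+u. ennreal (beta_dens a b u) * f u \<partial>lborel)"
  unfolding beta_distr_def beta_dens_def[symmetric] by (subst nn_integral_density) auto

lemma nn_integral_gamma_distr:
  assumes [measurable]: "f \<in> borel_measurable borel"
  shows "(\<integral>\<^sup>+v. f v \<partial>gamma_distr a) = (\<integral>\<^sup>+v. ennreal (gamma_dens a v) * f v \<partial>lborel)"
  unfolding gamma_distr_def gamma_dens_def[symmetric] by (subst nn_integral_density) auto

lemma AE_gamma_distr_pos: "AE v in gamma_distr a. v > 0"
  unfolding gamma_distr_def by (subst AE_density) (auto simp: indicator_def intro!: AE_I2)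

lemma AE_beta_distr_unit: "AE u in beta_distr a b. 0 < u \<and> u < 1"
  unfolding beta_distr_def by (subst AE_density) (auto simp: indicator_def intro!: AE_I2)

text \<open>The change of variables from two gamma variables to their sum \<open>v\<close> and
  proportion \<open>u\<close>, with Jacobian \<open>v\<close>. The exponent of \<open>v\<close> is 1
  + (p - 1) + (q - 1) = p + q - 1, the exponentials multiply to \<open>exp (- v)\<close>, and the
  constants agree because \<open>Beta p q\<close> is the quotient of
  \<open>Gamma p * Gamma q\<close> by \<open>Gamma (p + q)\<close>.\<close>

lemma gamma_dens_split:
  assumes "p > 0" "q > 0" "v > 0"
  shows "v * (gamma_dens p (v * u) * gamma_dens q (v - v * u)) = gamma_dens (p + q) v * beta_dens p q u"
proof (cases "0 < u \<and> u < 1")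
  case True
  have *: "v - v * u = v * (1 - u)" by (simp add: algebra_simps)
  have v: "v powr (p + q - 1) = v * (v powr (p - 1) * v powr (q - 1))"
    using assms powr_add[of v 1 "p - 1 + (q - 1)"] by (simp add: powr_add[symmetric] algebra_simps)
  have e: "exp (- (v * u)) * exp (- (v * (1 - u))) = exp (- v)"
    by (simp add: mult_exp_exp algebra_simps)
  have "v * (gamma_dens p (v * u) * gamma_dens q (v - v * u))
      = (v * (v powr (p - 1) * v powr (q - 1))) * (u powr (p - 1) * (1 - u) powr (q - 1))
        * (exp (- (v * u)) * exp (- (v * (1 - u)))) / (Gamma p * Gamma q)"
    using True assms by (simp add: gamma_dens_def * powr_mult)
  also have "\<dots> = gamma_dens (p + q) v * beta_dens p q u"
    using True assms Gamma_real_pos[of "p + q", THEN less_imp_neq]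
    by (simp add: e v[symmetric] gamma_dens_def beta_dens_def Beta_def)
  finally show ?thesis .
next
  case False
  then have "\<not> (v * u > 0 \<and> v - v * u > 0)" using assms(3)
    by (simp add: zero_less_mult_iff)
  then have "gamma_dens p (v * u) * gamma_dens q (v - v * u) = 0"
    by (auto simp: gamma_dens_def)
  moreover have "beta_dens p q u = 0" using False by (auto simp: beta_dens_def)
  ultimately show ?thesis by simp
qed

text \<open>The sum of two independent gamma variables is independent of the proportion due to the
  first one. Read left to right, this splits a gamma variable into two independent parts; read right
  to left, it replaces a pair by its total and proportion.\<close>

lemma nn_integral_beta_gamma:
  fixes f :: "real \<Rightarrow> real \<Rightarrow> ennreal"
  assumes pq: "p > 0" "q > 0"
    and [measurable]: "case_prod f \<in> borel_measurable (borel \<Otimes>\<^sub>M borel)"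
  shows "(\<integral>\<^sup>+v. \<integral>\<^sup>+u. f (u * v) ((1 - u) * v) \<partial>beta_distr p q \<partial>gamma_distr (p + q))
    = (\<integral>\<^sup>+s. \<integral>\<^sup>+t. f s t \<partial>gamma_distr q \<partial>gamma_distr p)"
proof -
  interpret B: prob_space "beta_distr p q" by (rule prob_space_beta_distr) fact+
  interpret G: prob_space "gamma_distr q" by (rule prob_space_gamma_distr) fact+
  let ?g = "gamma_dens"
  have "(\<integral>\<^sup>+s. \<integral>\<^sup>+t. f s t \<partial>gamma_distr q \<partial>gamma_distr p)
      = (\<integral>\<^sup>+s. ?g p s * (\<integral>\<^sup>+t. ?g q t * f s t \<partial>lborel) \<partial>lborel)"
    by (simp add: nn_integral_gamma_distr)
  \<comment> \<open>For fixed \<open>s\<close>, the total v = s + t replaces \<open>t\<close> by a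
    translation; after Fubini, \<open>s\<close> is rescaled to the proportion u = s / v.\<close>
  also have "\<dots> = (\<integral>\<^sup>+s. \<integral>\<^sup>+v. ?g p s * (?g q (v - s) * f s (v - s)) \<partial>lborel \<partial>lborel)"
  proof (rule nn_integral_cong)
    fix s :: real
    have "(\<integral>\<^sup>+t. ?g q t * f s t \<partial>lborel) = (\<integral>\<^sup>+v. ?g q (v - s) * f s (v - s) \<partial>lborel)"
      by (subst nn_integral_real_affine[where c = 1 and t = "- s"]) simp_all
    then show "?g p s * (\<integral>\<^sup>+t. ?g q t * f s t \<partial>lborel)
        = (\<integral>\<^sup>+v. ?g p s * (?g q (v - s) * f s (v - s)) \<partial>lborel)"
      by (simp add: nn_integral_cmult)
  qed
  also have "\<dots> = (\<integral>\<^sup>+v. \<integral>\<^sup>+s. ?g p s * (?g q (v - s) * f s (v - s)) \<partial>lborel \<partial>lborel)"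
    by (rule lborel_pair.Fubini') measurable
  also have "\<dots> = (\<integral>\<^sup>+v. ?g (p + q) v * (\<integral>\<^sup>+u. beta_dens p q u * f (u * v) ((1 - u) * v) \<partial>lborel) \<partial>lborel)"
  proof (rule nn_integral_cong)
    fix v :: real
    show "(\<integral>\<^sup>+s. ?g p s * (?g q (v - s) * f s (v - s)) \<partial>lborel)
        = ?g (p + q) v * (\<integral>\<^sup>+u. beta_dens p q u * f (u * v) ((1 - u) * v) \<partial>lborel)"
    \<comment> \<open>Rescaling by \<open>v\<close> needs v > 0. Otherwise \<open>s\<close> and
      \<open>v - s\<close> are never both positive, so the integrand vanishes identically.\<close>
    proof (cases "v > 0")
      case True
      have "(\<integral>\<^sup>+s. ?g p s * (?g q (v - s) * f s (v - s)) \<partial>lborel)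
          = v * (\<integral>\<^sup>+u. ?g p (v * u) * (?g q (v - v * u) * f (v * u) (v - v * u)) \<partial>lborel)"
        using True by (subst nn_integral_real_affine[where c = v and t = 0]) simp_all
      also have "\<dots> = (\<integral>\<^sup>+u. ?g (p + q) v * (beta_dens p q u * f (u * v) ((1 - u) * v)) \<partial>lborel)"
      proof (subst nn_integral_cmult[symmetric], simp, rule nn_integral_cong)
        fix u :: real
        have "ennreal v * (ennreal (?g p (v * u)) * ennreal (?g q (v - v * u)))
            = ennreal (?g (p + q) v) * ennreal (beta_dens p q u)"
          using gamma_dens_split[OF pq True] True pq
          by (simp add: gamma_dens_nonneg beta_dens_nonneg flip: ennreal_mult)
        then show "ennreal v * (ennreal (?g p (v * u)) * (ennreal (?g q (v - v * u)) * f (v * u) (v - v * u)))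
            = ennreal (?g (p + q) v) * (ennreal (beta_dens p q u) * f (u * v) ((1 - u) * v))"
          by (simp add: mult.assoc[symmetric] left_diff_distrib mult.commute[of u v])
      qed
      finally show ?thesis by (simp add: nn_integral_cmult)
    next
      case False
      then have "?g p s * ?g q (v - s) = 0" for s by (auto simp: gamma_dens_def indicator_def)
      then have "ennreal (?g p s) * (ennreal (?g q (v - s)) * f s (v - s)) = 0" for s
        by (metis ennreal_0 mult_eq_0_iff mult_zero_left)
      then have "(\<integral>\<^sup>+s. ?g p s * (?g q (v - s) * f s (v - s)) \<partial>lborel) = 0"
        by (simp only: nn_integral_const mult_zero_left)
      moreover have "?g (p + q) v = 0" using False by (simp add: gamma_dens_def)
      ultimately show ?thesis by simp
    qed
  qed
  also have "\<dots> = (\<integral>\<^sup>+v. \<integral>\<^sup>+u. f (u * v) ((1 - u) * v) \<partial>beta_distr p q \<partial>gamma_distr (p + q))"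
    by (simp add: nn_integral_gamma_distr nn_integral_beta_distr)
  finally show ?thesis ..
qed

text \<open>For a test function of the sum alone, the two parts of \<open>v\<close> add up to
  \<open>v\<close> again, and the integral over the proportion is that of a constant.\<close>

lemma nn_integral_gamma_add:
  fixes f :: "real \<Rightarrow> ennreal"
  assumes pq: "p > 0" "q > 0" and [measurable]: "f \<in> borel_measurable borel"
  shows "(\<integral>\<^sup>+s. \<integral>\<^sup>+t. f (s + t) \<partial>gamma_distr q \<partial>gamma_distr p) = (\<integral>\<^sup>+v. f v \<partial>gamma_distr (p + q))"
proof -
  interpret B: prob_space "beta_distr p q" by (rule prob_space_beta_distr) fact+
  show ?thesis
    by (subst nn_integral_beta_gamma[OF pq, symmetric])
      (simp_all add: distrib_right[symmetric] B.emeasure_space_1)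
qed

lemma nn_integral_swap:
  fixes f :: "real \<Rightarrow> real \<Rightarrow> ennreal"
  assumes "prob_space N" "prob_space K" and [measurable_cong]: "sets N = sets borel" "sets K = sets borel"
    and [measurable]: "case_prod f \<in> borel_measurable (borel \<Otimes>\<^sub>M borel)"
  shows "(\<integral>\<^sup>+x. \<integral>\<^sup>+y. f x y \<partial>K \<partial>N) = (\<integral>\<^sup>+y. \<integral>\<^sup>+x. f x y \<partial>N \<partial>K)"
proof -
  interpret N: prob_space N by fact
  interpret K: prob_space K by fact
  interpret pair_sigma_finite N K ..
  show ?thesis by (rule Fubini'[symmetric]) measurable
qed

text \<open>Keeping the proportion \<open>A\<close> of \<open>s\<close> and \<open>B\<close> of
  \<open>t\<close> leaves kept parts of shapes \<open>w\<close> and \<open>y\<close> and discarded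
  parts of shapes \<open>y\<close> and \<open>z\<close>, all independent. The kept and discarded
  totals therefore have the same joint law as the original pair.\<close>

lemma nn_integral_gamma_thinning:
  fixes h :: "real \<Rightarrow> real \<Rightarrow> ennreal"
  assumes wyz: "w > 0" "y > 0" "z > 0"
    and [measurable]: "case_prod h \<in> borel_measurable (borel \<Otimes>\<^sub>M borel)"
  shows "(\<integral>\<^sup>+s. \<integral>\<^sup>+t. \<integral>\<^sup>+A. \<integral>\<^sup>+B. h (A * s + B * t) ((1 - A) * s + (1 - B) * t)
       \<partial>beta_distr y z \<partial>beta_distr w y \<partial>gamma_distr (y + z) \<partial>gamma_distr (w + y))
    = (\<integral>\<^sup>+s. \<integral>\<^sup>+t. h s t \<partial>gamma_distr (y + z) \<partial>gamma_distr (w + y))"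
proof -
  note [simp] = prob_space_beta_distr prob_space_gamma_distr
  interpret A: prob_space "beta_distr w y" using wyz by simp
  interpret B: prob_space "beta_distr y z" using wyz by simp
  interpret S: prob_space "gamma_distr (w + y)" using wyz by simp
  interpret T: prob_space "gamma_distr (y + z)" using wyz by simp
  interpret W: prob_space "gamma_distr w" using wyz by simp
  interpret Y: prob_space "gamma_distr y" using wyz by simp
  interpret Z: prob_space "gamma_distr z" using wyz by simp
  have "(\<integral>\<^sup>+s. \<integral>\<^sup>+t. \<integral>\<^sup>+A. \<integral>\<^sup>+B. h (A * s + B * t) ((1 - A) * s + (1 - B) * t)
       \<partial>beta_distr y z \<partial>beta_distr w y \<partial>gamma_distr (y + z) \<partial>gamma_distr (w + y))
    = (\<integral>\<^sup>+s. \<integral>\<^sup>+A. \<integral>\<^sup>+t. \<integral>\<^sup>+B. h (A * s + B * t) ((1 - A) * s + (1 - B) * t)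
       \<partial>beta_distr y z \<partial>gamma_distr (y + z) \<partial>beta_distr w y \<partial>gamma_distr (w + y))"
    using wyz by (intro nn_integral_cong nn_integral_swap) simp_all
  also have "\<dots> = (\<integral>\<^sup>+s. \<integral>\<^sup>+A. \<integral>\<^sup>+t1. \<integral>\<^sup>+t2. h (A * s + t1) ((1 - A) * s + t2)
       \<partial>gamma_distr z \<partial>gamma_distr y \<partial>beta_distr w y \<partial>gamma_distr (w + y))"
    using wyz by (intro nn_integral_cong nn_integral_beta_gamma) simp_all
  also have "\<dots> = (\<integral>\<^sup>+s1. \<integral>\<^sup>+s2. \<integral>\<^sup>+t1. \<integral>\<^sup>+t2. h (s1 + t1) (s2 + t2)
       \<partial>gamma_distr z \<partial>gamma_distr y \<partial>gamma_distr y \<partial>gamma_distr w)"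
    using wyz by (intro nn_integral_beta_gamma) simp_all
  \<comment> \<open>The discarded part \<open>s2\<close> of the first variable and the kept part
    \<open>t1\<close> of the second trade places, so that kept parts are adjacent and each total can
    be merged.\<close>
  also have "\<dots> = (\<integral>\<^sup>+s1. \<integral>\<^sup>+t1. \<integral>\<^sup>+s2. \<integral>\<^sup>+t2. h (s1 + t1) (s2 + t2)
       \<partial>gamma_distr z \<partial>gamma_distr y \<partial>gamma_distr y \<partial>gamma_distr w)"
    using wyz by (intro nn_integral_cong nn_integral_swap) simp_all
  also have "\<dots> = (\<integral>\<^sup>+s1. \<integral>\<^sup>+t1. \<integral>\<^sup>+t. h (s1 + t1) t
       \<partial>gamma_distr (y + z) \<partial>gamma_distr y \<partial>gamma_distr w)"
    using wyz by (intro nn_integral_cong nn_integral_gamma_add) simp_all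
  also have "\<dots> = (\<integral>\<^sup>+s. \<integral>\<^sup>+t. h s t \<partial>gamma_distr (y + z) \<partial>gamma_distr (w + y))"
    using wyz by (intro nn_integral_gamma_add) simp_all
  finally show ?thesis .
qed

lemma measure_eqI_nn_integral:
  assumes "sets N = sets K"
    and "\<And>f::'a \<Rightarrow> ennreal. f \<in> borel_measurable K \<Longrightarrow> (\<integral>\<^sup>+x. f x \<partial>N) = (\<integral>\<^sup>+x. f x \<partial>K)"
  shows "N = K"
proof (rule measure_eqI)
  fix X assume "X \<in> sets N"
  with assms(1) assms(2)[of "indicator X"] show "emeasure N X = emeasure K X" by simp
qed fact

text \<open>This is the first marginal of the thinning identity: \<open>A * s + B * t\<close> is the
  kept total.\<close>

lemma solves_sum_eq_gamma:
  assumes wyz: "w > 0" "y > 0" "z > 0"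
  shows "solves_sum_eq (beta_distr w y \<Otimes>\<^sub>M beta_distr y z) (gamma_distr (y + z)) (gamma_distr (w + y))"
  unfolding solves_sum_eq_def
proof (intro conjI measure_eqI_nn_integral)
  note [simp] = prob_space_beta_distr prob_space_gamma_distr
  interpret A: prob_space "beta_distr w y" using wyz by simp
  interpret B: prob_space "beta_distr y z" using wyz by simp
  interpret S: prob_space "gamma_distr (w + y)" using wyz by simp
  interpret T: prob_space "gamma_distr (y + z)" using wyz by simp
  interpret AB: prob_space "beta_distr w y \<Otimes>\<^sub>M beta_distr y z" by (intro prob_space_pair) unfold_locales
  interpret TAB: prob_space "gamma_distr (y + z) \<Otimes>\<^sub>M (beta_distr w y \<Otimes>\<^sub>M beta_distr y z)"
    by (intro prob_space_pair) unfold_locales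
  show "prob_space (gamma_distr (w + y))" by unfold_locales
  fix f :: "real \<Rightarrow> ennreal"
  assume "f \<in> borel_measurable (distr (gamma_distr (w + y) \<Otimes>\<^sub>M
            gamma_distr (y + z) \<Otimes>\<^sub>M beta_distr w y \<Otimes>\<^sub>M beta_distr y z)
           borel (\<lambda>(v1, v2, A, B). A * v1 + B * v2))"
  then have [measurable]: "f \<in> borel_measurable borel" by simp
  have "(\<integral>\<^sup>+v. f v \<partial>distr (gamma_distr (w + y) \<Otimes>\<^sub>M
            gamma_distr (y + z) \<Otimes>\<^sub>M beta_distr w y \<Otimes>\<^sub>M beta_distr y z)
           borel (\<lambda>(v1, v2, A, B). A * v1 + B * v2))
      = (\<integral>\<^sup>+s. \<integral>\<^sup>+t. \<integral>\<^sup>+A. \<integral>\<^sup>+B. f (A * s + B * t)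
       \<partial>beta_distr y z \<partial>beta_distr w y \<partial>gamma_distr (y + z) \<partial>gamma_distr (w + y))"
    by (simp add: nn_integral_distr TAB.nn_integral_fst[symmetric] AB.nn_integral_fst[symmetric]
        B.nn_integral_fst[symmetric])
  also have "\<dots> = (\<integral>\<^sup>+v. f v \<partial>gamma_distr (w + y))"
    by (subst nn_integral_gamma_thinning[OF wyz, where h = "\<lambda>s t. f s"])
      (simp_all add: T.emeasure_space_1)
  finally show "(\<integral>\<^sup>+v. f v \<partial>gamma_distr (w + y)) = (\<integral>\<^sup>+v. f v \<partial>distr (gamma_distr (w + y) \<Otimes>\<^sub>M
            gamma_distr (y + z) \<Otimes>\<^sub>M beta_distr w y \<Otimes>\<^sub>M beta_distr y z)
           borel (\<lambda>(v1, v2, A, B). A * v1 + B * v2))" ..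
qed simp_all

text \<open>Multiplying the equation by an independent \<open>S \<sim> \<Gamma>\<^bsub>a+b\<^esub>\<close> turns
  \<open>(X S, (1 - X) S)\<close> into a pair of independent gamma variables, to which thinning applies;
  the beta variable is recovered as the ratio \<open>s / (s + t)\<close>.\<close>

lemma solves_mix_eq_beta:
  assumes wyz: "w > 0" "y > 0" "z > 0"
  shows "solves_mix_eq (beta_distr w y \<Otimes>\<^sub>M beta_distr y z) (beta_distr (w + y) (y + z))"
  unfolding solves_mix_eq_def
proof (intro conjI measure_eqI_nn_integral)
  note [simp] = prob_space_beta_distr prob_space_gamma_distr
  interpret A: prob_space "beta_distr w y" using wyz by simp
  interpret B: prob_space "beta_distr y z" using wyz by simp
  interpret X: prob_space "beta_distr (w + y) (y + z)" using wyz by simp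
  interpret T: prob_space "gamma_distr (y + z)" using wyz by simp
  interpret S: prob_space "gamma_distr (w + y + (y + z))" using wyz by simp
  interpret AB: prob_space "beta_distr w y \<Otimes>\<^sub>M beta_distr y z" by (intro prob_space_pair) unfold_locales
  show "prob_space (beta_distr (w + y) (y + z))" by unfold_locales
  let ?D = "distr (beta_distr (w + y) (y + z) \<Otimes>\<^sub>M beta_distr w y \<Otimes>\<^sub>M beta_distr y z)
           borel (\<lambda>(x, A, B). A * x + B * (1 - x))"
  fix f :: "real \<Rightarrow> ennreal"
  assume "f \<in> borel_measurable ?D"
  then have [measurable]: "f \<in> borel_measurable borel" by simp
  define h where "h s t = f (s / (s + t))" for s t :: real
  have h [measurable]: "case_prod h \<in> borel_measurable (borel \<Otimes>\<^sub>M borel)"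
    unfolding h_def by measurable
  have pos: "w + y > 0" "y + z > 0" using wyz by simp_all
  have hs: "h (x * S) ((1 - x) * S) = f x" if "S > 0" for x S
    using that by (simp add: h_def left_diff_distrib)
  have "(\<integral>\<^sup>+x. f x \<partial>?D) = (\<integral>\<^sup>+x. \<integral>\<^sup>+A. \<integral>\<^sup>+B. f (A * x + B * (1 - x))
       \<partial>beta_distr y z \<partial>beta_distr w y \<partial>beta_distr (w + y) (y + z))"
    by (simp add: nn_integral_distr AB.nn_integral_fst[symmetric] B.nn_integral_fst[symmetric])
  \<comment> \<open>An independent total \<open>S\<close> is inserted; the integrand is constant in
    it and its law has mass 1.\<close>
  also have "\<dots> = (\<integral>\<^sup>+S. \<integral>\<^sup>+x. \<integral>\<^sup>+A. \<integral>\<^sup>+B. f (A * x + B * (1 - x))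
       \<partial>beta_distr y z \<partial>beta_distr w y \<partial>beta_distr (w + y) (y + z) \<partial>gamma_distr (w + y + (y + z)))"
    by (simp only: nn_integral_const S.emeasure_space_1 mult_1_right)
  also have "\<dots> = (\<integral>\<^sup>+S. \<integral>\<^sup>+x. \<integral>\<^sup>+A. \<integral>\<^sup>+B.
         h (A * (x * S) + B * ((1 - x) * S)) ((1 - A) * (x * S) + (1 - B) * ((1 - x) * S))
       \<partial>beta_distr y z \<partial>beta_distr w y \<partial>beta_distr (w + y) (y + z) \<partial>gamma_distr (w + y + (y + z)))"
  \<comment> \<open>The two arguments of \<open>h\<close> add up to \<open>S\<close>, so
    \<open>S\<close> cancels in the ratio. This needs S > 0, hence an equality almost everywhere
    only.\<close>
  proof (rule nn_integral_cong_AE, rule eventually_mono[OF AE_gamma_distr_pos], intro nn_integral_cong)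
    fix S x A B :: real assume "S > 0"
    then show "f (A * x + B * (1 - x))
        = h (A * (x * S) + B * ((1 - x) * S)) ((1 - A) * (x * S) + (1 - B) * ((1 - x) * S))"
      by (subst hs[symmetric, of S]) (auto simp: algebra_simps intro!: arg_cong2[where f = h])
  qed
  also have "\<dots> = (\<integral>\<^sup>+s. \<integral>\<^sup>+t. \<integral>\<^sup>+A. \<integral>\<^sup>+B. h (A * s + B * t) ((1 - A) * s + (1 - B) * t)
       \<partial>beta_distr y z \<partial>beta_distr w y \<partial>gamma_distr (y + z) \<partial>gamma_distr (w + y))"
    using pos by (intro nn_integral_beta_gamma) simp_all
  also have "\<dots> = (\<integral>\<^sup>+s. \<integral>\<^sup>+t. h s t \<partial>gamma_distr (y + z) \<partial>gamma_distr (w + y))"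
    by (rule nn_integral_gamma_thinning) fact+
  also have "\<dots> = (\<integral>\<^sup>+S. \<integral>\<^sup>+x. h (x * S) ((1 - x) * S)
       \<partial>beta_distr (w + y) (y + z) \<partial>gamma_distr (w + y + (y + z)))"
    by (rule nn_integral_beta_gamma[symmetric]) fact+
  also have "\<dots> = (\<integral>\<^sup>+S. \<integral>\<^sup>+x. f x \<partial>beta_distr (w + y) (y + z) \<partial>gamma_distr (w + y + (y + z)))"
    by (rule nn_integral_cong_AE, rule eventually_mono[OF AE_gamma_distr_pos])
      (intro nn_integral_cong hs)
  also have "\<dots> = (\<integral>\<^sup>+x. f x \<partial>beta_distr (w + y) (y + z))"
    by (simp only: nn_integral_const S.emeasure_space_1 mult_1_right)
  finally show "(\<integral>\<^sup>+x. f x \<partial>beta_distr (w + y) (y + z)) = (\<integral>\<^sup>+x. f x \<partial>?D)" ..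
qed simp_all

section \<open>Random affine maps\<close>

text \<open>A map is encoded by its slope and intercept. The two recursions have the forms
  \<open>(A - B, B)\<close> and \<open>(A, B * V)\<close>, so one theory of affine maps serves
  both.\<close>

definition affine_map :: "real \<times> real \<Rightarrow> real \<Rightarrow> real" where
  "affine_map p x = fst p * x + snd p"

lemma measurable_affine_map [measurable]:
  "case_prod affine_map \<in> borel_measurable ((borel \<Otimes>\<^sub>M borel) \<Otimes>\<^sub>M borel)"
  unfolding affine_map_def by measurable

lemma affine_map_diff: "affine_map p x - affine_map p x' = fst p * (x - x')"
  by (simp add: affine_map_def algebra_simps)

text \<open>The assumptions concern the values at the endpoints 0 and 1; every other value is a
  convex combination of these.\<close>

lemma affine_map_unit_interval:
  assumes "snd p \<in> {0..1}" "fst p + snd p \<in> {0..1}" "x \<in> {0..1}"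
  shows "affine_map p x \<in> {0..1}"
proof -
  have "affine_map p x = (1 - x) *\<^sub>R snd p + x *\<^sub>R (fst p + snd p)"
    by (simp add: affine_map_def algebra_simps)
  also have "\<dots> \<in> {0..1}"
    using assms by (intro convexD_alt) auto
  finally show ?thesis .
qed

section \<open>Iterates of a deterministic sequence of affine maps\<close>

lemma forward_iter_cong:
  "(\<And>i. i \<in> {1..n} \<Longrightarrow> F i = F' i) \<Longrightarrow> forward_iter F n = forward_iter F' n"
  by (induction n) auto

lemma backward_iter_cong:
  "(\<And>i. i \<in> {1..n} \<Longrightarrow> F i = F' i) \<Longrightarrow> backward_iter F n = backward_iter F' n"
  by (induction n) auto

lemma measurable_forward_iter_affine:
  assumes "g \<in> borel_measurable N" "\<And>i. i \<in> {1..n} \<Longrightarrow> (\<lambda>s. W s i) \<in> N \<rightarrow>\<^sub>M borel \<Otimes>\<^sub>M borel"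
  shows "(\<lambda>s. forward_iter (\<lambda>i. affine_map (W s i)) n (g s)) \<in> borel_measurable N"
  using assms
proof (induction n)
  case (Suc n)
  have [measurable]: "(\<lambda>s. forward_iter (\<lambda>i. affine_map (W s i)) n (g s)) \<in> borel_measurable N"
    using Suc by auto
  have [measurable]: "(\<lambda>s. W s (Suc n)) \<in> N \<rightarrow>\<^sub>M borel \<Otimes>\<^sub>M borel"
    using Suc.prems by auto
  show ?case by simp
qed simp

text \<open>In a backward iterate the newest map acts first, so the induction step changes the
  starting point. This is why the starting point is a measurable function \<open>g\<close> and the
  induction generalises over it.\<close>

lemma measurable_backward_iter_affine:
  assumes "g \<in> borel_measurable N" "\<And>i. i \<in> {1..n} \<Longrightarrow> (\<lambda>s. W s i) \<in> N \<rightarrow>\<^sub>M borel \<Otimes>\<^sub>M borel"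
  shows "(\<lambda>s. backward_iter (\<lambda>i. affine_map (W s i)) n (g s)) \<in> borel_measurable N"
  using assms
proof (induction n arbitrary: g)
  case (Suc n)
  have [measurable]: "(\<lambda>s. W s (Suc n)) \<in> N \<rightarrow>\<^sub>M borel \<Otimes>\<^sub>M borel"
    using Suc.prems by auto
  note [measurable] = Suc.prems(1)
  have "(\<lambda>s. affine_map (W s (Suc n)) (g s)) \<in> borel_measurable N"
    by measurable
  from Suc.IH[OF this] Suc.prems show ?case by simp
qed simp

lemma backward_iter_affine_diff:
  "backward_iter (\<lambda>i. affine_map (W i)) n x - backward_iter (\<lambda>i. affine_map (W i)) n x'
    = (\<Prod>i\<in>{1..n}. fst (W i)) * (x - x')"
  by (induction n arbitrary: x x') (simp_all add: affine_map_diff)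

lemma uniform_limit_backward_iter_affine:
  fixes W :: "nat \<Rightarrow> real \<times> real"
  defines "Y \<equiv> backward_iter (\<lambda>i. affine_map (W i))"
  assumes inv: "\<And>i x. i \<ge> 1 \<Longrightarrow> x \<in> {0..1} \<Longrightarrow> affine_map (W i) x \<in> {0..1}"
    and lim: "(\<lambda>n. \<Prod>i\<in>{1..n}. \<bar>fst (W i)\<bar>) \<longlonglongrightarrow> 0"
  shows "uniform_limit {0..1} Y (\<lambda>_. lim (\<lambda>n. Y n 0)) sequentially"
proof -
  define D where "D n = (\<Prod>i\<in>{1..n}. \<bar>fst (W i)\<bar>)" for n
  \<comment> \<open>\<open>Y m x\<close> equals \<open>Y n\<close> evaluated at the image of
    \<open>x\<close> under the maps with indices n + 1 to m, and these preserve [0, 1].\<close>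
  have nested: "Y m x \<in> Y n ` {0..1}" if "n \<le> m" "x \<in> {0..1}" for n m x
    using that
  proof (induction m arbitrary: x rule: dec_induct)
    case base
    then show ?case by (rule imageI)
  next
    case (step m)
    have "Y m (affine_map (W (Suc m)) x) \<in> Y n ` {0..1}"
      by (rule step.IH, rule inv) (use step.prems in simp_all)
    then show ?case unfolding Y_def backward_iter.simps comp_def .
  qed
  have le: "\<bar>Y m x - Y n x'\<bar> \<le> D n" if "n \<le> m" "x \<in> {0..1}" "x' \<in> {0..1}" for n m x x'
  proof -
    from nested[OF that(1,2)] obtain u where u: "Y m x = Y n u" "u \<in> {0..1}" by (rule imageE)
    have "\<bar>Y n u - Y n x'\<bar> = D n * \<bar>u - x'\<bar>"
      by (simp add: Y_def backward_iter_affine_diff D_def abs_mult abs_prod)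
    also have "\<dots> \<le> D n * 1"
      using u(2) that(3) by (intro mult_left_mono) (simp_all add: D_def prod_nonneg abs_le_iff)
    finally show ?thesis using u by simp
  qed
  have D: "D \<longlonglongrightarrow> 0" using lim by (simp add: D_def[abs_def])
  have "Cauchy (\<lambda>n. Y n 0)"
  proof (rule metric_CauchyI)
    fix e :: real assume "e > 0"
    then have "\<forall>\<^sub>F n in sequentially. D n < e / 2"
      by (intro order_tendstoD(2)[OF D]) simp
    then obtain N where N: "D N < e / 2"
      by (rule eventually_happens'[OF sequentially_bot, THEN exE])
    have "dist (Y m 0) (Y n 0) < e" if "m \<ge> N" "n \<ge> N" for m n
      using le[OF that(1), of 0 0] le[OF that(2), of 0 0] N by (simp add: dist_real_def)
    then show "\<exists>N. \<forall>m\<ge>N. \<forall>n\<ge>N. dist (Y m 0) (Y n 0) < e" by blast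
  qed
  then have L: "(\<lambda>n. Y n 0) \<longlonglongrightarrow> lim (\<lambda>n. Y n 0)"
    by (rule convergent_LIMSEQ_iff[THEN iffD1, OF Cauchy_convergent])
  \<comment> \<open>Letting m tend to infinity in \<open>le\<close> gives a bound \<open>D n\<close>
    free of \<open>x\<close>, which is the uniformity.\<close>
  have bound: "\<bar>lim (\<lambda>n. Y n 0) - Y n x\<bar> \<le> D n" if "x \<in> {0..1}" for n x
  proof (rule tendsto_upperbound)
    show "(\<lambda>m. \<bar>Y m 0 - Y n x\<bar>) \<longlonglongrightarrow> \<bar>lim (\<lambda>n. Y n 0) - Y n x\<bar>"
      by (intro tendsto_intros L)
    show "\<forall>\<^sub>F m in sequentially. \<bar>Y m 0 - Y n x\<bar> \<le> D n"
      using eventually_ge_at_top[of n] by eventually_elim (rule le[OF _ _ that], simp_all)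
  qed simp
  show ?thesis
  proof (rule uniform_limitI)
    fix e :: real assume "e > 0"
    from order_tendstoD(2)[OF D this]
    show "\<forall>\<^sub>F n in sequentially. \<forall>x\<in>{0..1}. dist (Y n x) (lim (\<lambda>n. Y n 0)) < e"
    proof eventually_elim
      case (elim n)
      show ?case
      proof
        fix x :: real assume "x \<in> {0..1}"
        from bound[OF this, of n] elim show "dist (Y n x) (lim (\<lambda>n. Y n 0)) < e"
          unfolding dist_real_def by linarith
      qed
    qed
  qed
qed

text \<open>Pulling out the unimodular factor \<open>iexp (t * y)\<close> reduces this to the
  first-order bound for the exponential. It makes characters admissible as bounded Lipschitz test
  functions.\<close>

lemma iexp_lipschitz: "cmod (iexp (t * x) - iexp (t * y)) \<le> \<bar>t\<bar> * \<bar>x - y\<bar>"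
proof -
  have "iexp (t * x) - iexp (t * y) = iexp (t * y) * (iexp (t * (x - y)) - 1)"
    by (simp add: right_diff_distrib exp_diff)
  then have "cmod (iexp (t * x) - iexp (t * y)) = cmod (iexp (t * (x - y)) - 1)"
    by (simp add: norm_mult)
  also have "\<dots> \<le> \<bar>t * (x - y)\<bar>"
    using iexp_approx1[of "t * (x - y)" 0] by simp
  finally show ?thesis by (simp add: abs_mult)
qed

section \<open>The transfer operator of a contracting random affine map\<close>

locale random_affine = prob_space \<sigma> for \<sigma> :: "(real \<times> real) measure" +
  assumes sets_sigma [simp, measurable_cong]: "sets \<sigma> = sets (borel \<Otimes>\<^sub>M borel)"
    and contracting: "AE p in \<sigma>. \<bar>fst p\<bar> < 1"
begin

definition transfer :: "(real \<Rightarrow> complex) \<Rightarrow> real \<Rightarrow> complex" where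
  "transfer f x = (\<integral>p. f (affine_map p x) \<partial>\<sigma>)"

definition rate :: real where
  "rate = (\<integral>p. \<bar>fst p\<bar> \<partial>\<sigma>)"

text \<open>Invariance in dual form, tested on bounded measurable functions: \<open>transfer\<close>
  preserves this class, so invariance passes to all powers of the operator.\<close>

definition stationary :: "real measure \<Rightarrow> bool" where
  "stationary \<nu> \<longleftrightarrow> real_distribution \<nu> \<and>
    (\<forall>f K. f \<in> borel_measurable borel \<longrightarrow> (\<forall>x. norm (f x) \<le> K) \<longrightarrow>
      (\<integral>x. transfer f x \<partial>\<nu>) = (\<integral>x. f x \<partial>\<nu>))"

lemma integrable_slope: "integrable \<sigma> (\<lambda>p. \<bar>fst p\<bar>)"
proof (rule integrable_const_bound[where B = 1])
  show "AE p in \<sigma>. norm \<bar>fst p\<bar> \<le> 1"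
    using contracting by eventually_elim simp
qed measurable

lemma rate_nonneg: "0 \<le> rate"
  by (simp add: rate_def)

text \<open>Slopes may come arbitrarily close to 1 in absolute value, but an almost sure strict
  inequality stays strict under the expectation.\<close>

lemma rate_less_1: "rate < 1"
  unfolding rate_def by (rule expectation_less[OF integrable_slope contracting])

context
  fixes f :: "real \<Rightarrow> complex" and K :: real
  assumes f [measurable]: "f \<in> borel_measurable borel" and bound: "\<And>x. norm (f x) \<le> K"
begin

lemma integrable_transfer: "integrable \<sigma> (\<lambda>p. f (affine_map p x))"
  by (rule integrable_const_bound[where B = K]) (simp_all add: bound)

lemma measurable_transfer: "transfer f \<in> borel_measurable borel"
  unfolding transfer_def by measurable

lemma transfer_bound: "norm (transfer f x) \<le> K"
proof -
  have "norm (transfer f x) \<le> (\<integral>p. norm (f (affine_map p x)) \<partial>\<sigma>)"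
    unfolding transfer_def by (rule integral_norm_bound)
  also have "\<dots> \<le> (\<integral>p. K \<partial>\<sigma>)"
    by (intro integral_mono integrable_norm integrable_transfer bound) simp
  finally show ?thesis by (simp add: prob_space)
qed

lemma transfer_lipschitz:
  assumes "\<And>x y. norm (f x - f y) \<le> L * \<bar>x - y\<bar>"
  shows "norm (transfer f x - transfer f y) \<le> L * rate * \<bar>x - y\<bar>"
proof -
  have "norm (transfer f x - transfer f y) = norm (\<integral>p. f (affine_map p x) - f (affine_map p y) \<partial>\<sigma>)"
    unfolding transfer_def
    by (subst Bochner_Integration.integral_diff) (auto intro: integrable_transfer)
  also have "\<dots> \<le> (\<integral>p. norm (f (affine_map p x) - f (affine_map p y)) \<partial>\<sigma>)"
    by (rule integral_norm_bound)
  also have "\<dots> \<le> (\<integral>p. L * \<bar>x - y\<bar> * \<bar>fst p\<bar> \<partial>\<sigma>)"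
  proof (intro integral_mono integrable_norm Bochner_Integration.integrable_diff integrable_transfer
      integrable_mult_right integrable_slope)
    fix p
    show "norm (f (affine_map p x) - f (affine_map p y)) \<le> L * \<bar>x - y\<bar> * \<bar>fst p\<bar>"
      using assms[of "affine_map p x" "affine_map p y"] by (simp add: affine_map_diff abs_mult mult_ac)
  qed
  finally show ?thesis by (simp add: rate_def mult_ac)
qed

end

lemma
  assumes f: "f \<in> borel_measurable borel" "\<And>x. norm (f x) \<le> K"
  shows measurable_transfer_funpow: "(transfer ^^ n) f \<in> borel_measurable borel"
    and transfer_funpow_bound: "norm ((transfer ^^ n) f x) \<le> K"
proof -
  have "(transfer ^^ n) f \<in> borel_measurable borel \<and> (\<forall>x. norm ((transfer ^^ n) f x) \<le> K)"
  proof (induction n)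
    case (Suc n)
    with measurable_transfer[of "(transfer ^^ n) f" K] transfer_bound[of "(transfer ^^ n) f" K]
    show ?case by simp
  qed (use f in simp)
  then show "(transfer ^^ n) f \<in> borel_measurable borel" "norm ((transfer ^^ n) f x) \<le> K" by auto
qed

lemma transfer_funpow_lipschitz:
  assumes f: "f \<in> borel_measurable borel" "\<And>x. norm (f x) \<le> K"
    and "\<And>x y. norm (f x - f y) \<le> L * \<bar>x - y\<bar>"
  shows "norm ((transfer ^^ n) f x - (transfer ^^ n) f y) \<le> L * rate ^ n * \<bar>x - y\<bar>"
proof (induction n arbitrary: x y)
  case (Suc n)
  from transfer_lipschitz[OF measurable_transfer_funpow[OF f] transfer_funpow_bound[OF f] Suc.IH]
  show ?case by (simp add: mult_ac)
qed (use assms in simp)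

lemma stationaryD:
  assumes "stationary \<nu>" "f \<in> borel_measurable borel" "\<And>x. norm (f x) \<le> K"
  shows "(\<integral>x. transfer f x \<partial>\<nu>) = (\<integral>x. f x \<partial>\<nu>)"
  using assms(1)[unfolded stationary_def, THEN conjunct2, rule_format, OF assms(2,3)] .

lemma stationary_funpow:
  assumes "stationary \<nu>" and f: "f \<in> borel_measurable borel" "\<And>x. norm (f x) \<le> K"
  shows "(\<integral>x. (transfer ^^ n) f x \<partial>\<nu>) = (\<integral>x. f x \<partial>\<nu>)"
proof (induction n)
  case (Suc n)
  have "(\<integral>x. transfer ((transfer ^^ n) f) x \<partial>\<nu>) = (\<integral>x. (transfer ^^ n) f x \<partial>\<nu>)"
    by (rule stationaryD[OF assms(1) measurable_transfer_funpow[OF f] transfer_funpow_bound[OF f]])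
  with Suc show ?case by simp
qed simp

text \<open>By stationarity the error is the integral over \<open>y\<close> of the difference of the
  n-th transfer at \<open>x\<close> and at \<open>y\<close>, which tends to 0 by the geometric
  Lipschitz bound. The factor \<bar>x - y\<bar> in that bound may fail to be integrable in
  \<open>y\<close>, so the domination comes from the constant 2 K instead.\<close>

lemma transfer_funpow_tendsto:
  assumes stat: "stationary \<nu>" and f: "f \<in> borel_measurable borel" "\<And>x. norm (f x) \<le> K"
    and lip: "\<And>x y. norm (f x - f y) \<le> L * \<bar>x - y\<bar>"
  shows "(\<lambda>n. (transfer ^^ n) f x) \<longlonglongrightarrow> (\<integral>x. f x \<partial>\<nu>)"
proof -
  interpret N: real_distribution \<nu> using stat by (simp add: stationary_def)
  note [measurable] = measurable_transfer_funpow[OF f]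
  have int: "integrable \<nu> ((transfer ^^ n) f)" for n
    by (rule N.integrable_const_bound[where B = K]) (auto intro: transfer_funpow_bound[OF f])
  have "(\<lambda>n. \<integral>y. (transfer ^^ n) f x - (transfer ^^ n) f y \<partial>\<nu>) \<longlonglongrightarrow> (\<integral>y. 0 \<partial>\<nu>)"
  proof (rule integral_dominated_convergence[where w = "\<lambda>_. 2 * K"])
    show "AE y in \<nu>. (\<lambda>n. (transfer ^^ n) f x - (transfer ^^ n) f y) \<longlonglongrightarrow> 0"
    proof (rule AE_I2, rule Lim_null_comparison)
      fix y
      show "\<forall>\<^sub>F n in sequentially. norm ((transfer ^^ n) f x - (transfer ^^ n) f y)
          \<le> L * rate ^ n * \<bar>x - y\<bar>"
        by (intro always_eventually allI transfer_funpow_lipschitz[OF f lip])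
      have "(\<lambda>n. rate ^ n) \<longlonglongrightarrow> 0"
        by (rule LIMSEQ_power_zero) (use rate_nonneg rate_less_1 in simp)
      then show "(\<lambda>n. L * rate ^ n * \<bar>x - y\<bar>) \<longlonglongrightarrow> 0"
        by (intro tendsto_mult_left_zero tendsto_mult_right_zero)
    qed
    show "AE y in \<nu>. norm ((transfer ^^ n) f x - (transfer ^^ n) f y) \<le> 2 * K" for n
      using norm_triangle_ineq4[of "(transfer ^^ n) f x"] transfer_funpow_bound[OF f]
      by (intro AE_I2) (smt (verit))
  qed auto
  then have "(\<lambda>n. (transfer ^^ n) f x - (\<integral>y. f y \<partial>\<nu>)) \<longlonglongrightarrow> 0"
    using int by (simp add: stationary_funpow[OF stat f] N.prob_space[unfolded N.space_eq_univ])
  then show ?thesis by (rule LIM_zero_cancel)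
qed

lemma transfer_iexp_tendsto:
  assumes "stationary \<nu>"
  shows "(\<lambda>n. (transfer ^^ n) (\<lambda>x. iexp (t * x)) x) \<longlonglongrightarrow> char \<nu> t"
  unfolding char_def
  by (rule transfer_funpow_tendsto[OF assms, where K = 1 and L = "\<bar>t\<bar>"])
    (use iexp_lipschitz[of t] in simp_all)

text \<open>The sequence of transfers of a character does not involve the stationary law, yet its
  limit is the characteristic function of any such law.\<close>

lemma stationary_unique:
  assumes "stationary \<nu>" "stationary \<nu>'"
  shows "\<nu> = \<nu>'"
proof (rule Levy_uniqueness)
  show "real_distribution \<nu>" "real_distribution \<nu>'" using assms by (auto simp: stationary_def)
  show "char \<nu> = char \<nu>'"
    by (rule ext, rule LIMSEQ_unique[OF transfer_iexp_tendsto[OF assms(1), where x = 0]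
          transfer_iexp_tendsto[OF assms(2)]])
qed

text \<open>Turns a fixed-point equation in distribution into invariance, by Fubini and a change of
  variables. \<open>N\<close> is the law of the driving randomness and \<phi> computes slope and
  intercept from it.\<close>

lemma stationaryI:
  assumes "prob_space \<nu>" "sets \<nu> = sets borel" "prob_space N"
    and phi [measurable]: "\<phi> \<in> N \<rightarrow>\<^sub>M borel \<Otimes>\<^sub>M borel" and sigma: "\<sigma> = distr N (borel \<Otimes>\<^sub>M borel) \<phi>"
    and eq: "\<nu> = distr (\<nu> \<Otimes>\<^sub>M N) borel (\<lambda>(x, s). affine_map (\<phi> s) x)"
  shows "stationary \<nu>"
  unfolding stationary_def
proof (intro conjI allI impI)
  show "real_distribution \<nu>"
    using assms by (simp add: real_distribution_def real_distribution_axioms_def)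
  interpret V: prob_space \<nu> by fact
  interpret N: prob_space N by fact
  interpret VN: pair_prob_space \<nu> N ..
  note [measurable_cong] = assms(2)
  fix f :: "real \<Rightarrow> complex" and K
  assume [measurable]: "f \<in> borel_measurable borel" and K: "\<forall>x. norm (f x) \<le> K"
  have "(\<integral>x. transfer f x \<partial>\<nu>) = (\<integral>x. (\<integral>s. f (affine_map (\<phi> s) x) \<partial>N) \<partial>\<nu>)"
    unfolding transfer_def by (subst sigma) (simp add: integral_distr)
  also have "\<dots> = (\<integral>(x, s). f (affine_map (\<phi> s) x) \<partial>(\<nu> \<Otimes>\<^sub>M N))"
    by (rule VN.integral_fst, rule VN.integrable_const_bound[where B = K]) (use K in auto)
  also have "\<dots> = (\<integral>x. f x \<partial>distr (\<nu> \<Otimes>\<^sub>M N) borel (\<lambda>(x, s). affine_map (\<phi> s) x))"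
    by (simp add: integral_distr case_prod_unfold)
  finally show "(\<integral>x. transfer f x \<partial>\<nu>) = (\<integral>x. f x \<partial>\<nu>)"
    by (simp flip: eq)
qed

end

section \<open>Laws and limits of iterates of i.i.d. affine maps\<close>

locale iid_random_affine = random_affine \<sigma> + P: prob_space M
  for \<sigma> :: "(real \<times> real) measure" and M :: "'w measure" +
  fixes W :: "'w \<Rightarrow> nat \<Rightarrow> real \<times> real"
  assumes indep: "P.indep_vars (\<lambda>_. borel \<Otimes>\<^sub>M borel) (\<lambda>i \<omega>. W \<omega> i) {1..}"
    and distr_W: "\<And>i. i \<ge> 1 \<Longrightarrow> distr M (borel \<Otimes>\<^sub>M borel) (\<lambda>\<omega>. W \<omega> i) = \<sigma>"
begin

lemma measurable_W: "i \<ge> 1 \<Longrightarrow> (\<lambda>\<omega>. W \<omega> i) \<in> M \<rightarrow>\<^sub>M borel \<Otimes>\<^sub>M borel"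
  using indep by (simp add: P.indep_vars_def)

sublocale S: product_prob_space "\<lambda>_::nat. \<sigma>" UNIV
  by unfold_locales

lemma distr_restrict_W:
  "distr M (Pi\<^sub>M {1..n} (\<lambda>_. \<sigma>)) (\<lambda>\<omega>. \<lambda>i\<in>{1..n}. W \<omega> i) = Pi\<^sub>M {1..n} (\<lambda>_. \<sigma>)"
proof (cases "n = 0")
  \<comment> \<open>The product form of independence used in the other case is for nonempty index
    sets; here both sides are the point mass on the one-point space.\<close>
  case True
  have "(\<lambda>\<omega>. \<lambda>i\<in>{}. W \<omega> i) = (\<lambda>_. \<lambda>_. undefined)" by (simp add: fun_eq_iff)
  with True show ?thesis
    by (intro measure_eqI)
      (auto simp: emeasure_distr sets_PiM_empty space_PiM_empty P.emeasure_space_1 PiM_empty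
        dest!: subset_singletonD)
next
  case False
  have "P.indep_vars (\<lambda>_. borel \<Otimes>\<^sub>M borel) (\<lambda>i \<omega>. W \<omega> i) {1..n}"
    by (rule P.indep_vars_subset[OF indep]) auto
  with False have "distr M (Pi\<^sub>M {1..n} (\<lambda>_. borel \<Otimes>\<^sub>M borel)) (\<lambda>\<omega>. \<lambda>i\<in>{1..n}. W \<omega> i)
      = Pi\<^sub>M {1..n} (\<lambda>i. distr M (borel \<Otimes>\<^sub>M borel) (\<lambda>\<omega>. W \<omega> i))"
    by (subst (asm) P.indep_vars_iff_distr_eq_PiM') (auto intro: measurable_W)
  also have "\<dots> = Pi\<^sub>M {1..n} (\<lambda>_. \<sigma>)"
    by (rule PiM_cong) (auto simp: distr_W)
  also have "distr M (Pi\<^sub>M {1..n} (\<lambda>_. borel \<Otimes>\<^sub>M borel)) (\<lambda>\<omega>. \<lambda>i\<in>{1..n}. W \<omega> i)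
      = distr M (Pi\<^sub>M {1..n} (\<lambda>_. \<sigma>)) (\<lambda>\<omega>. \<lambda>i\<in>{1..n}. W \<omega> i)"
    by (rule distr_cong) (auto intro!: sets_PiM_cong)
  finally show ?thesis .
qed

lemma integral_restrict_W:
  fixes h :: "(nat \<Rightarrow> real \<times> real) \<Rightarrow> complex"
  assumes "h \<in> borel_measurable (Pi\<^sub>M {1..n} (\<lambda>_. \<sigma>))"
  shows "(\<integral>\<omega>. h (restrict (W \<omega>) {1..n}) \<partial>M) = (\<integral>\<omega>. h \<omega> \<partial>Pi\<^sub>M {1..n} (\<lambda>_. \<sigma>))"
proof -
  have "(\<integral>\<omega>. h \<omega> \<partial>distr M (Pi\<^sub>M {1..n} (\<lambda>_. \<sigma>)) (\<lambda>\<omega>. \<lambda>i\<in>{1..n}. W \<omega> i))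
      = (\<integral>\<omega>. h (restrict (W \<omega>) {1..n}) \<partial>M)"
  proof (rule integral_distr[OF _ assms])
    have "(\<lambda>\<omega>. W \<omega> i) \<in> M \<rightarrow>\<^sub>M \<sigma>" if "i \<in> {1..n}" for i
      using measurable_W[of i] that by (simp add: measurable_cong_sets[OF refl sets_sigma])
    then show "(\<lambda>\<omega>. \<lambda>i\<in>{1..n}. W \<omega> i) \<in> M \<rightarrow>\<^sub>M Pi\<^sub>M {1..n} (\<lambda>_. \<sigma>)"
      by (intro measurable_restrict)
  qed
  then show ?thesis unfolding distr_restrict_W ..
qed

lemma measurable_PiM_component:
  "i \<in> I \<Longrightarrow> (\<lambda>\<omega>. \<omega> i) \<in> Pi\<^sub>M I (\<lambda>_. \<sigma>) \<rightarrow>\<^sub>M borel \<Otimes>\<^sub>M borel"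
  using measurable_component_singleton[of i I "\<lambda>_. \<sigma>"]
  by (simp add: measurable_cong_sets[OF refl sets_sigma])

lemma prob_space_PiM_sigma: "prob_space (Pi\<^sub>M I (\<lambda>_. \<sigma>))"
  by (rule prob_space_PiM) unfold_locales

text \<open>The newest map is outermost in a forward iterate. Integrating out its coordinate
  replaces \<open>f\<close> by \<open>transfer f\<close>, so the induction generalises over
  \<open>f\<close>.\<close>

lemma integral_PiM_forward:
  assumes f [measurable]: "f \<in> borel_measurable borel" and bound: "\<And>x. norm (f x) \<le> K"
  shows "(\<integral>\<omega>. f (forward_iter (\<lambda>i. affine_map (\<omega> i)) n x) \<partial>Pi\<^sub>M {1..n} (\<lambda>_. \<sigma>)) = (transfer ^^ n) f x"
  using f bound
proof (induction n arbitrary: f)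
  case 0
  interpret Q: prob_space "Pi\<^sub>M {1..0} (\<lambda>_::nat. \<sigma>)" by (rule prob_space_PiM_sigma)
  show ?case using Q.prob_space by simp
next
  case (Suc n)
  note f [measurable] = Suc.prems(1)
  interpret Q: prob_space "Pi\<^sub>M (insert (Suc n) {1..n}) (\<lambda>_::nat. \<sigma>)" by (rule prob_space_PiM_sigma)
  have ins: "{1..Suc n} = insert (Suc n) {1..n}" by auto
  have "(\<lambda>\<omega>. forward_iter (\<lambda>i. affine_map (\<omega> i)) (Suc n) x)
      \<in> borel_measurable (Pi\<^sub>M (insert (Suc n) {1..n}) (\<lambda>_. \<sigma>))"
    by (intro measurable_forward_iter_affine measurable_PiM_component) auto
  note meas = measurable_compose[OF this f]
  have "(\<integral>\<omega>. f (forward_iter (\<lambda>i. affine_map (\<omega> i)) (Suc n) x) \<partial>Pi\<^sub>M {1..Suc n} (\<lambda>_. \<sigma>))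
      = (\<integral>\<omega>. (\<integral>p. f (forward_iter (\<lambda>i. affine_map (fun_upd \<omega> (Suc n) p i)) (Suc n) x) \<partial>\<sigma>)
          \<partial>Pi\<^sub>M {1..n} (\<lambda>_. \<sigma>))"
    unfolding ins
    by (rule S.product_integral_insert, simp, simp, rule Q.integrable_const_bound[where B = K, OF _ meas])
      (simp add: Suc.prems(2))
  also have "\<dots> = (\<integral>\<omega>. transfer f (forward_iter (\<lambda>i. affine_map (\<omega> i)) n x) \<partial>Pi\<^sub>M {1..n} (\<lambda>_. \<sigma>))"
  proof -
    have "forward_iter (\<lambda>i. affine_map (fun_upd \<omega> (Suc n) p i)) n = forward_iter (\<lambda>i. affine_map (\<omega> i)) n"
      for \<omega> p by (rule forward_iter_cong) auto
    then show ?thesis by (simp add: transfer_def)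
  qed
  also have "\<dots> = (transfer ^^ Suc n) f x"
    unfolding funpow_Suc_right comp_def
    by (rule Suc.IH[OF measurable_transfer[OF Suc.prems] transfer_bound[OF Suc.prems]])
  finally show ?case .
qed

text \<open>The newest map is innermost here and moves the starting point to
  \<open>affine_map p x\<close>, so the induction generalises over \<open>x\<close>. Fubini puts
  \<open>p\<close> outside, and the remaining integral over \<open>p\<close> is the outermost
  transfer.\<close>

lemma integral_PiM_backward:
  assumes f [measurable]: "f \<in> borel_measurable borel" and bound: "\<And>x. norm (f x) \<le> K"
  shows "(\<integral>\<omega>. f (backward_iter (\<lambda>i. affine_map (\<omega> i)) n x) \<partial>Pi\<^sub>M {1..n} (\<lambda>_. \<sigma>)) = (transfer ^^ n) f x"
proof (induction n arbitrary: x)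
  case 0
  interpret Q: prob_space "Pi\<^sub>M {1..0} (\<lambda>_::nat. \<sigma>)" by (rule prob_space_PiM_sigma)
  show ?case using Q.prob_space by simp
next
  case (Suc n)
  interpret Q: prob_space "Pi\<^sub>M (insert (Suc n) {1..n}) (\<lambda>_::nat. \<sigma>)" by (rule prob_space_PiM_sigma)
  interpret R: prob_space "Pi\<^sub>M {1..n} (\<lambda>_::nat. \<sigma>)" by (rule prob_space_PiM_sigma)
  interpret RS: pair_prob_space "Pi\<^sub>M {1..n} (\<lambda>_::nat. \<sigma>)" \<sigma> ..
  have ins: "{1..Suc n} = insert (Suc n) {1..n}" by auto
  have "(\<lambda>\<omega>. backward_iter (\<lambda>i. affine_map (\<omega> i)) (Suc n) x)
      \<in> borel_measurable (Pi\<^sub>M (insert (Suc n) {1..n}) (\<lambda>_. \<sigma>))"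
    by (intro measurable_backward_iter_affine measurable_PiM_component) auto
  note meas = measurable_compose[OF this f]
  have "(\<lambda>\<omega>p. backward_iter (\<lambda>i. affine_map (fst \<omega>p i)) n (affine_map (snd \<omega>p) x))
      \<in> borel_measurable (Pi\<^sub>M {1..n} (\<lambda>_. \<sigma>) \<Otimes>\<^sub>M \<sigma>)"
    by (intro measurable_backward_iter_affine measurable_compose[OF measurable_fst measurable_PiM_component])
      auto
  note meas2 = measurable_compose[OF this f]
  have "(\<integral>\<omega>. f (backward_iter (\<lambda>i. affine_map (\<omega> i)) (Suc n) x) \<partial>Pi\<^sub>M {1..Suc n} (\<lambda>_. \<sigma>))
      = (\<integral>\<omega>. (\<integral>p. f (backward_iter (\<lambda>i. affine_map (fun_upd \<omega> (Suc n) p i)) (Suc n) x) \<partial>\<sigma>)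
          \<partial>Pi\<^sub>M {1..n} (\<lambda>_. \<sigma>))"
    unfolding ins
    by (rule S.product_integral_insert, simp, simp, rule Q.integrable_const_bound[where B = K, OF _ meas])
      (simp add: bound)
  also have "\<dots> = (\<integral>\<omega>. (\<integral>p. f (backward_iter (\<lambda>i. affine_map (\<omega> i)) n (affine_map p x)) \<partial>\<sigma>)
      \<partial>Pi\<^sub>M {1..n} (\<lambda>_. \<sigma>))"
  proof -
    have "backward_iter (\<lambda>i. affine_map (fun_upd \<omega> (Suc n) p i)) n = backward_iter (\<lambda>i. affine_map (\<omega> i)) n"
      for \<omega> p by (rule backward_iter_cong) auto
    then show ?thesis by simp
  qed
  also have "\<dots> = (\<integral>p. (\<integral>\<omega>. f (backward_iter (\<lambda>i. affine_map (\<omega> i)) n (affine_map p x))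
      \<partial>Pi\<^sub>M {1..n} (\<lambda>_. \<sigma>)) \<partial>\<sigma>)"
    by (rule RS.Fubini_integral[symmetric], rule RS.integrable_const_bound[where B = K])
      (use bound meas2 in \<open>simp_all add: case_prod_unfold\<close>)
  also have "\<dots> = (transfer ^^ Suc n) f x"
    unfolding Suc.IH by (simp add: transfer_def)
  finally show ?case .
qed

lemma integral_forward:
  assumes f: "f \<in> borel_measurable borel" "\<And>x. norm (f x) \<le> K"
  shows "(\<integral>\<omega>. f (forward_iter (\<lambda>i. affine_map (W \<omega> i)) n x) \<partial>M) = (transfer ^^ n) f x"
proof -
  have eq: "forward_iter (\<lambda>i. affine_map (W \<omega> i)) n = forward_iter (\<lambda>i. affine_map (restrict (W \<omega>) {1..n} i)) n"
    for \<omega> by (rule forward_iter_cong) auto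
  have "(\<lambda>\<omega>. forward_iter (\<lambda>i. affine_map (\<omega> i)) n x) \<in> borel_measurable (Pi\<^sub>M {1..n} (\<lambda>_. \<sigma>))"
    by (intro measurable_forward_iter_affine measurable_PiM_component) auto
  note integral_restrict_W[OF measurable_compose[OF this f(1)]]
  moreover have "(\<integral>\<omega>. f (forward_iter (\<lambda>i. affine_map (W \<omega> i)) n x) \<partial>M)
      = (\<integral>\<omega>. f (forward_iter (\<lambda>i. affine_map (restrict (W \<omega>) {1..n} i)) n x) \<partial>M)"
    by (rule Bochner_Integration.integral_cong[OF refl]) (simp only: eq)
  ultimately show ?thesis
    by (simp only: integral_PiM_forward[OF f])
qed

lemma integral_iexp_forward:
  "(\<integral>\<omega>. iexp (t * forward_iter (\<lambda>i. affine_map (W \<omega> i)) n x) \<partial>M) = (transfer ^^ n) (\<lambda>x. iexp (t * x)) x"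
  by (rule integral_forward[where K = 1]) simp_all

lemma integral_backward:
  assumes f: "f \<in> borel_measurable borel" "\<And>x. norm (f x) \<le> K"
  shows "(\<integral>\<omega>. f (backward_iter (\<lambda>i. affine_map (W \<omega> i)) n x) \<partial>M) = (transfer ^^ n) f x"
proof -
  have eq: "backward_iter (\<lambda>i. affine_map (W \<omega> i)) n = backward_iter (\<lambda>i. affine_map (restrict (W \<omega>) {1..n} i)) n"
    for \<omega> by (rule backward_iter_cong) auto
  have "(\<lambda>\<omega>. backward_iter (\<lambda>i. affine_map (\<omega> i)) n x) \<in> borel_measurable (Pi\<^sub>M {1..n} (\<lambda>_. \<sigma>))"
    by (intro measurable_backward_iter_affine measurable_PiM_component) auto
  note integral_restrict_W[OF measurable_compose[OF this f(1)]]
  moreover have "(\<integral>\<omega>. f (backward_iter (\<lambda>i. affine_map (W \<omega> i)) n x) \<partial>M)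
      = (\<integral>\<omega>. f (backward_iter (\<lambda>i. affine_map (restrict (W \<omega>) {1..n} i)) n x) \<partial>M)"
    by (rule Bochner_Integration.integral_cong[OF refl]) (simp only: eq)
  ultimately show ?thesis
    by (simp only: integral_PiM_backward[OF f])
qed

lemma integral_iexp_backward:
  "(\<integral>\<omega>. iexp (t * backward_iter (\<lambda>i. affine_map (W \<omega> i)) n x) \<partial>M) = (transfer ^^ n) (\<lambda>x. iexp (t * x)) x"
  by (rule integral_backward[where K = 1]) simp_all

lemma measurable_forward [measurable]:
  "(\<lambda>\<omega>. forward_iter (\<lambda>i. affine_map (W \<omega> i)) n x) \<in> borel_measurable M"
  by (intro measurable_forward_iter_affine measurable_W) auto

lemma measurable_backward [measurable]:
  "(\<lambda>\<omega>. backward_iter (\<lambda>i. affine_map (W \<omega> i)) n x) \<in> borel_measurable M"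
  by (intro measurable_backward_iter_affine measurable_W) auto

text \<open>The characteristic function of the n-th iterate is the n-th transfer of a character at
  \<open>x\<close>; its convergence yields weak convergence by Levy's continuity theorem.\<close>

lemma weak_conv_forward:
  assumes "stationary \<nu>"
  shows "weak_conv_m (\<lambda>n. distr M borel (\<lambda>\<omega>. forward_iter (\<lambda>i. affine_map (W \<omega> i)) n x)) \<nu>"
proof (rule levy_continuity)
  show "real_distribution \<nu>" using assms by (simp add: stationary_def)
  fix t
  have "char (distr M borel (\<lambda>\<omega>. forward_iter (\<lambda>i. affine_map (W \<omega> i)) n x)) t
      = (transfer ^^ n) (\<lambda>x. iexp (t * x)) x" for n
    unfolding char_def
    by (subst integral_distr) (simp, simp, rule integral_iexp_forward)
  then show "(\<lambda>n. char (distr M borel (\<lambda>\<omega>. forward_iter (\<lambda>i. affine_map (W \<omega> i)) n x)) t) \<longlonglongrightarrow> char \<nu> t"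
    using transfer_iexp_tendsto[OF assms] by simp
qed (rule P.real_distribution_distr, measurable)

text \<open>Expectations of characters converge along the backward iterates by dominated
  convergence, and they equal the same transfers, whose limit is \<open>char\<close> of
  \<nu>.\<close>

lemma distr_backward_limit:
  assumes "stationary \<nu>" and Y [measurable]: "Y \<in> borel_measurable M"
    and lim: "AE \<omega> in M. (\<lambda>n. backward_iter (\<lambda>i. affine_map (W \<omega> i)) n x) \<longlonglongrightarrow> Y \<omega>"
  shows "distr M borel Y = \<nu>"
proof (rule Levy_uniqueness)
  show "real_distribution \<nu>" using assms by (simp add: stationary_def)
  show "real_distribution (distr M borel Y)" by simp
  show "char (distr M borel Y) = char \<nu>"
  proof
    fix t
    have "(\<lambda>n. \<integral>\<omega>. iexp (t * backward_iter (\<lambda>i. affine_map (W \<omega> i)) n x) \<partial>M)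
        \<longlonglongrightarrow> (\<integral>\<omega>. iexp (t * Y \<omega>) \<partial>M)"
    proof (rule integral_dominated_convergence[where w = "\<lambda>_. 1"])
      show "AE \<omega> in M. (\<lambda>n. iexp (t * backward_iter (\<lambda>i. affine_map (W \<omega> i)) n x))
          \<longlonglongrightarrow> iexp (t * Y \<omega>)"
        using lim by eventually_elim (intro tendsto_intros)
    qed auto
    then have "(\<lambda>n. (transfer ^^ n) (\<lambda>x. iexp (t * x)) x) \<longlonglongrightarrow> (\<integral>\<omega>. iexp (t * Y \<omega>) \<partial>M)"
      by (simp only: integral_iexp_backward)
    from LIMSEQ_unique[OF this transfer_iexp_tendsto[OF assms(1)]]
    show "char (distr M borel Y) t = char \<nu> t"
      unfolding char_def by (subst integral_distr) simp_all
  qed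
qed

text \<open>By independence the products have expectations \<open>rate ^ n\<close>, whose sum is
  finite. Hence the series of products converges almost surely and its terms vanish in the
  limit.\<close>

lemma AE_prod_slopes_tendsto_0:
  "AE \<omega> in M. (\<lambda>n. \<Prod>i\<in>{1..n}. \<bar>fst (W \<omega> i)\<bar>) \<longlonglongrightarrow> 0"
proof -
  define D where "D n \<omega> = (\<Prod>i\<in>{1..n}. ennreal \<bar>fst (W \<omega> i)\<bar>)" for n \<omega>
  have mD [measurable]: "D n \<in> borel_measurable M" for n
  proof -
    have "(\<lambda>\<omega>. ennreal \<bar>fst (W \<omega> i)\<bar>) \<in> borel_measurable M" if "i \<in> {1..n}" for i
      using measurable_compose[OF measurable_W[of i], of "\<lambda>p. ennreal \<bar>fst p\<bar>" borel] that by simp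
    then show ?thesis unfolding D_def by (intro borel_measurable_prod_ennreal)
  qed
  have D: "(\<integral>\<^sup>+\<omega>. D n \<omega> \<partial>M) = ennreal (rate ^ n)" for n
  proof -
    have "P.indep_vars (\<lambda>_. borel \<Otimes>\<^sub>M borel) (\<lambda>i \<omega>. W \<omega> i) {1..n}"
      by (rule P.indep_vars_subset[OF indep]) auto
    then have "P.indep_vars (\<lambda>_. borel) (\<lambda>i \<omega>. ennreal \<bar>fst (W \<omega> i)\<bar>) {1..n}"
      by (rule P.indep_vars_compose2) simp
    then have "(\<integral>\<^sup>+\<omega>. D n \<omega> \<partial>M) = (\<Prod>i\<in>{1..n}. \<integral>\<^sup>+\<omega>. ennreal \<bar>fst (W \<omega> i)\<bar> \<partial>M)"
      unfolding D_def by (intro P.indep_vars_nn_integral) auto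
    also have "\<dots> = (\<Prod>i\<in>{1..n}. ennreal rate)"
    proof (rule prod.cong[OF refl])
      fix i assume i: "i \<in> {1..n}"
      have "(\<integral>\<^sup>+\<omega>. ennreal \<bar>fst (W \<omega> i)\<bar> \<partial>M)
          = (\<integral>\<^sup>+p. ennreal \<bar>fst p\<bar> \<partial>distr M (borel \<Otimes>\<^sub>M borel) (\<lambda>\<omega>. W \<omega> i))"
        using i by (subst nn_integral_distr) (auto intro: measurable_W)
      also have "\<dots> = ennreal rate"
        using i by (simp add: distr_W rate_def nn_integral_eq_integral integrable_slope)
      finally show "(\<integral>\<^sup>+\<omega>. ennreal \<bar>fst (W \<omega> i)\<bar> \<partial>M) = ennreal rate" .
    qed
    finally show ?thesis by (simp add: ennreal_power rate_nonneg)
  qed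
  have "(\<integral>\<^sup>+\<omega>. (\<Sum>n. D n \<omega>) \<partial>M) = (\<Sum>n. ennreal (rate ^ n))"
    by (subst nn_integral_suminf) (simp_all add: D)
  also have "\<dots> = ennreal (\<Sum>n. rate ^ n)"
    using rate_nonneg rate_less_1 by (intro suminf_ennreal2) (auto intro: summable_geometric)
  finally have "(\<integral>\<^sup>+\<omega>. (\<Sum>n. D n \<omega>) \<partial>M) \<noteq> \<infinity>" by simp
  then have "AE \<omega> in M. (\<Sum>n. D n \<omega>) \<noteq> \<infinity>"
    by (intro nn_integral_PInf_AE) measurable
  then show ?thesis
  proof eventually_elim
    case (elim \<omega>)
    then have "(\<Sum>n. ennreal (\<Prod>i\<in>{1..n}. \<bar>fst (W \<omega> i)\<bar>)) \<noteq> top"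
      by (simp add: D_def prod_ennreal)
    then show ?case
      by (intro summable_LIMSEQ_zero summable_suminf_not_top) (auto intro: prod_nonneg)
  qed
qed

lemma backward_iter_unit_interval:
  assumes "stationary \<nu>"
    and inv: "AE p in \<sigma>. snd p \<in> {0..1} \<and> fst p + snd p \<in> {0..1}"
  shows "\<exists>Y\<in>borel_measurable M. distr M borel Y = \<nu> \<and>
    (AE \<omega> in M. uniform_limit {0..1} (\<lambda>n x. backward_iter (\<lambda>i. affine_map (W \<omega> i)) n x)
      (\<lambda>_. Y \<omega>) sequentially)"
proof -
  \<comment> \<open>Using \<open>lim\<close> at the starting point 0 gives a function that is
    measurable on the whole space, including the null set where convergence may fail.\<close>
  define Y where "Y \<omega> = lim (\<lambda>n. backward_iter (\<lambda>i. affine_map (W \<omega> i)) n 0)" for \<omega>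
  have [measurable]: "Y \<in> borel_measurable M" unfolding Y_def by measurable
  have "AE \<omega> in M. \<forall>x\<in>{0..1}. affine_map (W \<omega> i) x \<in> {0..1}" if "i \<ge> 1" for i
  proof -
    have "AE \<omega> in M. snd (W \<omega> i) \<in> {0..1} \<and> fst (W \<omega> i) + snd (W \<omega> i) \<in> {0..1}"
      by (rule AE_distrD[OF measurable_W[OF that]]) (use inv in \<open>simp only: distr_W[OF that]\<close>)
    then show ?thesis
      by eventually_elim (blast intro: affine_map_unit_interval)
  qed
  \<comment> \<open>One exceptional null set for each of countably many indices, hence a common
    one.\<close>
  then have "AE \<omega> in M. \<forall>i\<in>{1..}. \<forall>x\<in>{0..1}. affine_map (W \<omega> i) x \<in> {0..1}"
    by (subst AE_ball_countable) auto
  with AE_prod_slopes_tendsto_0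
  have lim: "AE \<omega> in M. uniform_limit {0..1} (\<lambda>n x. backward_iter (\<lambda>i. affine_map (W \<omega> i)) n x)
      (\<lambda>_. Y \<omega>) sequentially"
    unfolding Y_def
    by eventually_elim (rule uniform_limit_backward_iter_affine, auto)
  then have "AE \<omega> in M. (\<lambda>n. backward_iter (\<lambda>i. affine_map (W \<omega> i)) n 0) \<longlonglongrightarrow> Y \<omega>"
    by eventually_elim (erule tendsto_uniform_limitI, simp)
  then have "distr M borel Y = \<nu>" by (intro distr_backward_limit assms) measurable
  with lim show ?thesis by auto
qed

end

section \<open>Iterations driven by beta variables\<close>

lemma AE_pair_beta_unit:
  assumes "w > 0" "y > 0" "z > 0"
  shows "AE (A, B) in beta_distr w y \<Otimes>\<^sub>M beta_distr y z. (0 < A \<and> A < 1) \<and> 0 < B \<and> B < 1"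
proof -
  interpret A: prob_space "beta_distr w y" using assms by (simp add: prob_space_beta_distr)
  interpret B: prob_space "beta_distr y z" using assms by (simp add: prob_space_beta_distr)
  interpret AB: pair_prob_space "beta_distr w y" "beta_distr y z" ..
  show ?thesis
  proof (rule AB.AE_pair_measure)
    show "AE A in beta_distr w y. AE B in beta_distr y z. case (A, B) of (A, B) \<Rightarrow> (0 < A \<and> A < 1) \<and> 0 < B \<and> B < 1"
      using AE_beta_distr_unit[of w y]
    proof eventually_elim
      case (elim A)
      show ?case using AE_beta_distr_unit[of y z] by eventually_elim (use elim in simp)
    qed
  qed measurable
qed

theorem theorem6:
  fixes w y z a b :: real
    and \<mu> :: "(real \<times> real) measure"
    and M :: "'w measure"
    and A B V :: "nat \<Rightarrow> 'w \<Rightarrow> real"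
  assumes "w > 0" and "y > 0" and "z > 0"
    and "a = w + y" and "b = y + z"
    and "\<mu> = beta_distr w y \<Otimes>\<^sub>M beta_distr y z"
    and "prob_space M"
    and "prob_space.indep_vars M (\<lambda>_. (borel \<Otimes>\<^sub>M borel) \<Otimes>\<^sub>M borel)
           (\<lambda>n \<omega>. ((A n \<omega>, B n \<omega>), V n \<omega>)) {1..}"
    and "\<And>n. n \<ge> 1 \<Longrightarrow>
           distr M ((borel \<Otimes>\<^sub>M borel) \<Otimes>\<^sub>M borel) (\<lambda>\<omega>. ((A n \<omega>, B n \<omega>), V n \<omega>))
           = \<mu> \<Otimes>\<^sub>M gamma_distr b"
  shows "(\<forall>\<nu>. solves_sum_eq \<mu> (gamma_distr b) \<nu> \<longleftrightarrow> \<nu> = gamma_distr a)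
    \<and> (\<forall>\<nu>. solves_mix_eq \<mu> \<nu> \<longleftrightarrow> \<nu> = beta_distr a b)
    \<and> (\<exists>Y \<in> borel_measurable M. distr M borel Y = beta_distr a b \<and>
         (AE \<omega> in M. uniform_limit {0..1}
            (\<lambda>n x. backward_iter (mix_map A B \<omega>) n x) (\<lambda>x. Y \<omega>) sequentially))
    \<and> (\<forall>x \<in> {0..1}. weak_conv_m
         (\<lambda>n. distr M borel (\<lambda>\<omega>. forward_iter (mix_map A B \<omega>) n x)) (beta_distr a b))
    \<and> (\<forall>x' \<in> {0<..}. weak_conv_m
         (\<lambda>n. distr M borel (\<lambda>\<omega>. forward_iter (sum_map A B V \<omega>) n x')) (gamma_distr a))"
proof -
  note pos = \<open>w > 0\<close> \<open>y > 0\<close> \<open>z > 0\<close> and a = \<open>a = w + y\<close> and b = \<open>b = y + z\<close>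
    and mu = \<open>\<mu> = _\<close> and indep = assms(8) and law = assms(9)
  interpret M: prob_space M by fact
  interpret A: prob_space "beta_distr w y" using pos by (simp add: prob_space_beta_distr)
  interpret B: prob_space "beta_distr y z" using pos by (simp add: prob_space_beta_distr)
  interpret AB: pair_prob_space "beta_distr w y" "beta_distr y z" ..
  interpret mu: prob_space \<mu> unfolding mu by unfold_locales
  interpret kappa: prob_space "gamma_distr b" using pos by (simp add: b prob_space_gamma_distr)
  interpret MK: pair_prob_space \<mu> "gamma_distr b" ..
  interpret KM: pair_prob_space "gamma_distr b" \<mu> ..
  have sets_mu [simp, measurable_cong]: "sets \<mu> = sets (borel \<Otimes>\<^sub>M borel)"
    unfolding mu by (rule sets_pair_measure_cong) simp_all
  have unit: "AE (A, B) in \<mu>. (0 < A \<and> A < 1) \<and> 0 < B \<and> B < 1"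
    unfolding mu by (rule AE_pair_beta_unit) fact+

  \<comment> \<open>A x + B (1 - x) = (A - B) x + B gives the slope and intercept.\<close>
  define mix :: "real \<times> real \<Rightarrow> real \<times> real" where "mix = (\<lambda>(A, B). (A - B, B))"
  \<comment> \<open>The argument order follows the product
    \<open>gamma_distr b \<Otimes>\<^sub>M \<mu>\<close> in \<open>solves_sum_eq\<close>.\<close>
  define sm :: "real \<times> real \<times> real \<Rightarrow> real \<times> real" where "sm = (\<lambda>(v, A, B). (A, B * v))"
  have [measurable]: "mix \<in> borel \<Otimes>\<^sub>M borel \<rightarrow>\<^sub>M borel \<Otimes>\<^sub>M borel"
    "sm \<in> borel \<Otimes>\<^sub>M (borel \<Otimes>\<^sub>M borel) \<rightarrow>\<^sub>M borel \<Otimes>\<^sub>M borel"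
    unfolding mix_def sm_def by measurable
  have mix_meas: "mix \<in> \<mu> \<rightarrow>\<^sub>M borel \<Otimes>\<^sub>M borel" by measurable
  have sm_meas: "sm \<in> gamma_distr b \<Otimes>\<^sub>M \<mu> \<rightarrow>\<^sub>M borel \<Otimes>\<^sub>M borel" by measurable
  define \<sigma> where "\<sigma> = distr \<mu> (borel \<Otimes>\<^sub>M borel) mix"
  define \<tau> where "\<tau> = distr (gamma_distr b \<Otimes>\<^sub>M \<mu>) (borel \<Otimes>\<^sub>M borel) sm"

  interpret mix: iid_random_affine \<sigma> M "\<lambda>\<omega> i. (A i \<omega> - B i \<omega>, B i \<omega>)"
  proof (intro iid_random_affine.intro random_affine.intro random_affine_axioms.intro
      iid_random_affine_axioms.intro M.prob_space_axioms)
    show "prob_space \<sigma>" unfolding \<sigma>_def by (rule mu.prob_space_distr) (rule mix_meas)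
    show "sets \<sigma> = sets (borel \<Otimes>\<^sub>M borel)" by (simp add: \<sigma>_def)
    show "AE p in \<sigma>. \<bar>fst p\<bar> < 1"
      unfolding \<sigma>_def
    proof (subst AE_distr_iff[OF mix_meas])
      \<comment> \<open>Two points of (0, 1) differ by less than 1.\<close>
      show "AE p in \<mu>. \<bar>fst (mix p)\<bar> < 1"
        using unit by eventually_elim (auto simp: mix_def)
    qed measurable
    show "M.indep_vars (\<lambda>_. borel \<Otimes>\<^sub>M borel) (\<lambda>i \<omega>. (A i \<omega> - B i \<omega>, B i \<omega>)) {1..}"
      using M.indep_vars_compose2[OF indep, of "\<lambda>_ x. mix (fst x)" "\<lambda>_. borel \<Otimes>\<^sub>M borel"]
      by (simp add: mix_def)
    fix i :: nat assume i: "1 \<le> i"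
    have [measurable]: "(\<lambda>\<omega>. ((A i \<omega>, B i \<omega>), V i \<omega>)) \<in> M \<rightarrow>\<^sub>M (borel \<Otimes>\<^sub>M borel) \<Otimes>\<^sub>M borel"
      using indep i by (simp add: M.indep_vars_def)
    have "distr M (borel \<Otimes>\<^sub>M borel) (\<lambda>\<omega>. (A i \<omega> - B i \<omega>, B i \<omega>))
      = distr (distr M ((borel \<Otimes>\<^sub>M borel) \<Otimes>\<^sub>M borel) (\<lambda>\<omega>. ((A i \<omega>, B i \<omega>), V i \<omega>)))
          (borel \<Otimes>\<^sub>M borel) (\<lambda>x. mix (fst x))"
      by (subst distr_distr) (simp_all add: comp_def mix_def)
    \<comment> \<open>The common law of the triples is projected to \<open>(A, B)\<close>,
      forgetting \<open>V\<close>.\<close>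
    also have "\<dots> = distr (distr (\<mu> \<Otimes>\<^sub>M gamma_distr b) \<mu> fst) (borel \<Otimes>\<^sub>M borel) mix"
      by (subst distr_distr) (simp_all add: law[OF i] comp_def mix_meas)
    finally show "distr M (borel \<Otimes>\<^sub>M borel) (\<lambda>\<omega>. (A i \<omega> - B i \<omega>, B i \<omega>)) = \<sigma>"
      by (simp add: kappa.distr_pair_fst \<sigma>_def)
  qed

  interpret sum: iid_random_affine \<tau> M "\<lambda>\<omega> i. (A i \<omega>, B i \<omega> * V i \<omega>)"
  proof (intro iid_random_affine.intro random_affine.intro random_affine_axioms.intro
      iid_random_affine_axioms.intro M.prob_space_axioms)
    show "prob_space \<tau>" unfolding \<tau>_def by (rule KM.prob_space_distr) (rule sm_meas)
    show "sets \<tau> = sets (borel \<Otimes>\<^sub>M borel)" by (simp add: \<tau>_def)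
    have "AE q in gamma_distr b \<Otimes>\<^sub>M \<mu>. \<bar>fst (snd q)\<bar> < 1"
    proof (rule KM.AE_pair_measure)
      have "AE p in \<mu>. \<bar>fst p\<bar> < 1" using unit by eventually_elim auto
      then show "AE v in gamma_distr b. AE p in \<mu>. \<bar>fst (snd (v, p))\<bar> < 1" by simp
    qed measurable
    then show "AE p in \<tau>. \<bar>fst p\<bar> < 1"
      unfolding \<tau>_def by (subst AE_distr_iff[OF sm_meas]) (simp_all add: sm_def case_prod_unfold)
    show "M.indep_vars (\<lambda>_. borel \<Otimes>\<^sub>M borel) (\<lambda>i \<omega>. (A i \<omega>, B i \<omega> * V i \<omega>)) {1..}"
      using M.indep_vars_compose2[OF indep, of "\<lambda>_ x. sm (snd x, fst x)" "\<lambda>_. borel \<Otimes>\<^sub>M borel"]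
      by (simp add: sm_def)
    fix i :: nat assume i: "1 \<le> i"
    have [measurable]: "(\<lambda>\<omega>. ((A i \<omega>, B i \<omega>), V i \<omega>)) \<in> M \<rightarrow>\<^sub>M (borel \<Otimes>\<^sub>M borel) \<Otimes>\<^sub>M borel"
      using indep i by (simp add: M.indep_vars_def)
    have "distr M (borel \<Otimes>\<^sub>M borel) (\<lambda>\<omega>. (A i \<omega>, B i \<omega> * V i \<omega>))
      = distr (distr M ((borel \<Otimes>\<^sub>M borel) \<Otimes>\<^sub>M borel) (\<lambda>\<omega>. ((A i \<omega>, B i \<omega>), V i \<omega>)))
          (borel \<Otimes>\<^sub>M borel) (\<lambda>x. sm (snd x, fst x))"
      by (subst distr_distr) (simp_all add: comp_def sm_def)
    \<comment> \<open>The triples carry \<open>V\<close> last while \<tau> is built with it first,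
      so the coordinates are swapped.\<close>
    also have "\<dots> = distr (distr (\<mu> \<Otimes>\<^sub>M gamma_distr b) (gamma_distr b \<Otimes>\<^sub>M \<mu>) (\<lambda>(x, y). (y, x)))
        (borel \<Otimes>\<^sub>M borel) sm"
      by (subst distr_distr) (simp_all add: law[OF i] comp_def sm_meas case_prod_unfold)
    finally show "distr M (borel \<Otimes>\<^sub>M borel) (\<lambda>\<omega>. (A i \<omega>, B i \<omega> * V i \<omega>)) = \<tau>"
      by (simp add: \<tau>_def flip: KM.distr_pair_swap)
  qed

  have mix_stat: "mix.stationary \<nu>" if "solves_mix_eq \<mu> \<nu>" for \<nu>
  proof (rule mix.stationaryI[OF _ _ mu.prob_space_axioms mix_meas \<sigma>_def])
    show "prob_space \<nu>" "sets \<nu> = sets borel" using that by (auto simp: solves_mix_eq_def)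
    have "(\<lambda>(x, s). affine_map (mix s) x) = (\<lambda>(x, A, B). A * x + B * (1 - x))"
      by (simp add: fun_eq_iff affine_map_def mix_def algebra_simps)
    then show "\<nu> = distr (\<nu> \<Otimes>\<^sub>M \<mu>) borel (\<lambda>(x, s). affine_map (mix s) x)"
      using that by (simp add: solves_mix_eq_def)
  qed
  have sum_stat: "sum.stationary \<nu>" if "solves_sum_eq \<mu> (gamma_distr b) \<nu>" for \<nu>
  proof (rule sum.stationaryI[OF _ _ KM.prob_space_axioms sm_meas \<tau>_def])
    show "prob_space \<nu>" "sets \<nu> = sets borel" using that by (auto simp: solves_sum_eq_def)
    have "(\<lambda>(x, s). affine_map (sm s) x) = (\<lambda>(v1, v2, A, B). A * v1 + B * v2)"
      by (simp add: fun_eq_iff affine_map_def sm_def)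
    then show "\<nu> = distr (\<nu> \<Otimes>\<^sub>M gamma_distr b \<Otimes>\<^sub>M \<mu>) borel (\<lambda>(x, s). affine_map (sm s) x)"
      using that by (simp add: solves_sum_eq_def)
  qed
  have beta: "solves_mix_eq \<mu> (beta_distr a b)"
    unfolding mu a b by (rule solves_mix_eq_beta) fact+
  have gamma: "solves_sum_eq \<mu> (gamma_distr b) (gamma_distr a)"
    unfolding mu a b by (rule solves_sum_eq_gamma) fact+
  have mix_map: "mix_map A B \<omega> = (\<lambda>i. affine_map (A i \<omega> - B i \<omega>, B i \<omega>))" for \<omega>
    by (simp add: fun_eq_iff mix_map_def affine_map_def algebra_simps)
  have sum_map: "sum_map A B V \<omega> = (\<lambda>i. affine_map (A i \<omega>, B i \<omega> * V i \<omega>))" for \<omega>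
    by (simp add: fun_eq_iff sum_map_def affine_map_def)
  \<comment> \<open>The mixing map takes the value \<open>B\<close> at 0 and \<open>A\<close> at 1,
    both in the unit interval.\<close>
  have "AE p in \<mu>. snd (mix p) \<in> {0..1} \<and> fst (mix p) + snd (mix p) \<in> {0..1}"
    using unit by eventually_elim (auto simp: mix_def)
  then have "AE p in \<sigma>. snd p \<in> {0..1} \<and> fst p + snd p \<in> {0..1}"
    unfolding \<sigma>_def by (subst AE_distr_iff[OF mix_meas]) simp_all
  with mix_stat[OF beta] have "\<exists>Y \<in> borel_measurable M. distr M borel Y = beta_distr a b \<and>
         (AE \<omega> in M. uniform_limit {0..1}
            (\<lambda>n x. backward_iter (mix_map A B \<omega>) n x) (\<lambda>x. Y \<omega>) sequentially)"
    unfolding mix_map by (rule mix.backward_iter_unit_interval)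
  moreover have "solves_sum_eq \<mu> (gamma_distr b) \<nu> \<longleftrightarrow> \<nu> = gamma_distr a" for \<nu>
    using gamma sum.stationary_unique sum_stat by blast
  moreover have "solves_mix_eq \<mu> \<nu> \<longleftrightarrow> \<nu> = beta_distr a b" for \<nu>
    using beta mix.stationary_unique mix_stat by blast
  moreover have "weak_conv_m (\<lambda>n. distr M borel (\<lambda>\<omega>. forward_iter (mix_map A B \<omega>) n x)) (beta_distr a b)" for x
    unfolding mix_map by (rule mix.weak_conv_forward[OF mix_stat[OF beta]])
  moreover have "weak_conv_m (\<lambda>n. distr M borel (\<lambda>\<omega>. forward_iter (sum_map A B V \<omega>) n x')) (gamma_distr a)" for x'
    unfolding sum_map by (rule sum.weak_conv_forward[OF sum_stat[OF gamma]])
  ultimately show ?thesis by blast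
qed

end
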